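(* Let $M\ge 1$ and let $\{z_\alpha(p,\boldsymbol{t})\}_{\alpha=1}^M$ be functions of a complex variable $p$ and of the times $\boldsymbol{t}=\{t_A: A\in\boldsymbol{A}\}$ having the Laurent expansions $$z_1(p,\boldsymbol{t})=p+\sum_{n=1}^{\infty}\frac{a_{1,n}(\boldsymbol{t})}{p^n},\quad p\to\infty,$$ $$z_i(p,\boldsymbol{t})=\frac{a_{i,-1}(\boldsymbol{t})}{p-q_i(\boldsymbol{t})}+\sum_{n=0}^{\infty}a_{i,n}(\boldsymbol{t})\,(p-q_i(\boldsymbol{t}))^n,\quad p\to q_i(\boldsymbol{t}),\quad 2\le i\le M,$$ and satisfying time-independent relations $$z_i=f_i(z),\quad z:=z_1,\quad 2\le i\le M,$$ where each $f_i$ is a function of $z$ alone (not depending on $\boldsymbol{t}$). Let $p=p(z,\boldsymbol{t})$ denote the inverse function of $z=z_1(p,\boldsymbol{t})$, and let $\Omega_A=\Omega_A(p,\boldsymbol{t})$, $A\in\boldsymbol{A}$, be the functions associated with $\{z_\alpha\}_{\alpha=1}^M$ as defined in the context. If there exists a function $S(z,\boldsymbol{t})$ such that $$\frac{\partial S(z,\boldsymbol{t})}{\partial t_A}=\Omega_A(p(z,\boldsymbol{t}),\boldsymbol{t})\quad\text{for all }A\in\boldsymbol{A},$$ then the functions $z_\alpha(p,\boldsymbol{t})$ provide a solution of the Whitham hierarchy; that is, the functions $\Omega_A$ satisfy $$\frac{\partial \Omega_A}{\partial t_B}-\frac{\partial \Omega_B}{\partial t_A}+\{\Omega_A,\Omega_B\}=0\quad\text{for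 all }A,B\in\boldsymbol{A},$$ these being the compatibility conditions of the system $\dfrac{\partial z_\alpha}{\partial t_A}=\{\Omega_A,z_\alpha\}$, $1\le\alpha\le M$, $A\in\boldsymbol{A}$.
   Context: Index set: $\boldsymbol{A}=\{(\alpha,0): 2\le\alpha\le M\}\cup\{(\alpha,n): 1\le\alpha\le M,\ n\ge 1\}$. The times $t_A$, $A\in\boldsymbol{A}$, are complex parameters, and $x:=t_{(1,1)}$. Each $z_\alpha$ is defined, as a function of $p$, on a neighborhood $\mathcal{D}$ of $\infty$ in the extended complex plane, on which it has a simple pole at the point $q_\alpha=q_\alpha(\boldsymbol{t})$, with $q_1=\infty$. All functions are assumed to depend smoothly (analytically) on their arguments wherever they are differentiated. Poisson bracket: $\{F_1,F_2\}:=\dfrac{\partial F_1}{\partial p}\dfrac{\partial F_2}{\partial x}-\dfrac{\partial F_1}{\partial x}\dfrac{\partial F_2}{\partial p}$, for functions of $(p,\boldsymbol{t})$; partial derivatives with respect to the times are taken at fixed $p$. The functions $\Omega_A$: $\Omega_{(i,0)}(p,\boldsymbol{t})=-\ln(p-q_i(\boldsymbol{t}))$ for $2\le i\le M$, and $\Omega_{(\alpha,n)}=\big((z_\alpha)^n\big)_+$ for $1\le\alpha\le M$, $n\ge1$. Here, for $\alpha=1$, $(\cdot)_+$ takes the polynomial part of the Laurent series at $p=\infty$, i.e. $\big(\sum_{n=-\infty}^{\infty} a_np^n\big)_+=\sum_{n\ge0}a_np^n$ (so that $\Omega_{(1,1)}=p$), and for $\alpha=i$ with $2\le i\le M$, $(\cdot)_+$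 takes the strictly singular part of the Laurent series at $p=q_i(\boldsymbol{t})$, i.e. $\big(\sum_{n=-\infty}^{\infty} b_n(p-q_i)^n\big)_+=\sum_{n\ge1}b_{-n}(p-q_i)^{-n}$. The ($M$-th, zero genus) Whitham hierarchy is by definition the set of equations $\partial_{t_B}\Omega_A-\partial_{t_A}\Omega_B+\{\Omega_A,\Omega_B\}=0$, $A,B\in\boldsymbol{A}$. *)

theory Defs
  imports "HOL-Complex_Analysis.Complex_Analysis"
begin

type_synonym times = "nat \<times> nat \<Rightarrow> complex"

definition whitham_index :: "nat \<Rightarrow> (nat \<times> nat) set" where
  "whitham_index M = {(\<alpha>, 0) |\<alpha>. 2 \<le> \<alpha> \<and> \<alpha> \<le> M} \<union> {(\<alpha>, n) |\<alpha> n. 1 \<le> \<alpha> \<and> \<alpha> \<le> M \<and> 1 \<le> n}"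

(* There are infinitely many times, and no topology on the space of all of them is singled out.
   Openness and analyticity in (p, t) therefore refer to p together with an arbitrary finite set J
   of times, the remaining times being frozen. On such a slice, which is a copy of
   C^(1 + card J), they are the usual notions: open set, and complex (Frechet) differentiability. *)

definition slice_ball ::
    "(nat \<times> nat) set \<Rightarrow> complex \<Rightarrow> times \<Rightarrow> real \<Rightarrow> (complex \<times> times) set" where
  "slice_ball J p t r =
     {(p', t'). norm (p' - p) < r \<and> (\<forall>A\<in>J. norm (t' A - t A) < r) \<and> (\<forall>A. A \<notin> J \<longrightarrow> t' A = t A)}"

definition slice_open :: "(nat \<times> nat) set \<Rightarrow> (complex \<times> times) set \<Rightarrow> bool" where
  "slice_open I U \<longleftrightarrow>
     (\<forall>(p, t)\<in>U. \<forall>J. finite J \<and> J \<subseteq> I \<longrightarrow> (\<exists>r>0. slice_ball J p t r \<subseteq> U))"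

definition slice_holomorphic ::
    "(nat \<times> nat) set \<Rightarrow> (complex \<Rightarrow> times \<Rightarrow> complex) \<Rightarrow> (complex \<times> times) set \<Rightarrow> bool" where
  "slice_holomorphic I F U \<longleftrightarrow> slice_open I U \<and>
     (\<forall>(p, t)\<in>U. \<forall>J. finite J \<and> J \<subseteq> I \<longrightarrow>
        (\<exists>c d. \<forall>e>0. \<exists>r>0. \<forall>(p', t')\<in>slice_ball J p t r.
           norm (F p' t' - F p t - c * (p' - p) - (\<Sum>A\<in>J. d A * (t' A - t A)))
             \<le> e * (norm (p' - p) + (\<Sum>A\<in>J. norm (t' A - t A)))))"

definition d_spec :: "(complex \<Rightarrow> times \<Rightarrow> complex) \<Rightarrow> complex \<Rightarrow> times \<Rightarrow> complex" where
  "d_spec F p t = deriv (\<lambda>w. F w t) p"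

definition d_time :: "nat \<times> nat \<Rightarrow> (complex \<Rightarrow> times \<Rightarrow> complex) \<Rightarrow> complex \<Rightarrow> times \<Rightarrow> complex" where
  "d_time A F p t = deriv (\<lambda>s. F p (t(A := s))) (t A)"

definition poisson ::
    "(complex \<Rightarrow> times \<Rightarrow> complex) \<Rightarrow> (complex \<Rightarrow> times \<Rightarrow> complex) \<Rightarrow> complex \<Rightarrow> times \<Rightarrow> complex" where
  "poisson F G p t =
     d_spec F p t * d_time (1, 1) G p t - d_time (1, 1) F p t * d_spec G p t"

(* The Laurent series of f at infinity is that of f (1/w) at w = 0, so the coefficient of p^n is
   the coefficient of w^(-n). fls_prpart is the polynomial collecting the strictly negative
   powers. *)
definition poly_part_at_infinity :: "(complex \<Rightarrow> complex) \<Rightarrow> complex \<Rightarrow> complex" where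
  "poly_part_at_infinity f p =
     (let L = laurent_expansion (\<lambda>w. f (inverse w)) 0 in fls_nth L 0 + poly (fls_prpart L) p)"

definition singular_part_at :: "complex \<Rightarrow> (complex \<Rightarrow> complex) \<Rightarrow> complex \<Rightarrow> complex" where
  "singular_part_at q f p = poly (fls_prpart (laurent_expansion f q)) (inverse (p - q))"

(* The argument lg i is a branch of ln (p - q_i). *)
definition whitham_Omega ::
    "(nat \<Rightarrow> complex \<Rightarrow> times \<Rightarrow> complex) \<Rightarrow> (nat \<Rightarrow> times \<Rightarrow> complex) \<Rightarrow>
     (nat \<Rightarrow> complex \<Rightarrow> times \<Rightarrow> complex) \<Rightarrow> nat \<times> nat \<Rightarrow> complex \<Rightarrow> times \<Rightarrow> complex" where
  "whitham_Omega z q lg A p t =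
     (case A of (\<alpha>, n) \<Rightarrow>
        if n = 0 then - lg \<alpha> p t
        else if \<alpha> = 1 then poly_part_at_infinity (\<lambda>w. z 1 w t ^ n) p
        else singular_part_at (q \<alpha> t) (\<lambda>w. z \<alpha> w t ^ n) p)"

definition whitham_curvature ::
    "(nat \<times> nat \<Rightarrow> complex \<Rightarrow> times \<Rightarrow> complex) \<Rightarrow> nat \<times> nat \<Rightarrow> nat \<times> nat \<Rightarrow>
     complex \<Rightarrow> times \<Rightarrow> complex" where
  "whitham_curvature Om A B p t =
     d_time B (Om A) p t - d_time A (Om B) p t + poisson (Om A) (Om B) p t"

definition whitham_hierarchy_on ::
    "(nat \<times> nat) set \<Rightarrow> (nat \<times> nat \<Rightarrow> complex \<Rightarrow> times \<Rightarrow> complex) \<Rightarrow> (complex \<times> times) set \<Rightarrow> bool"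
  where
  "whitham_hierarchy_on I Om U \<longleftrightarrow>
     (\<forall>A\<in>I. \<forall>B\<in>I. \<forall>(p, t)\<in>U. whitham_curvature Om A B p t = 0)"

(* The linear system dF/dt_A = {Om_A, F} reads lax_op Om A F = 0. *)
definition lax_op ::
    "(nat \<times> nat \<Rightarrow> complex \<Rightarrow> times \<Rightarrow> complex) \<Rightarrow> nat \<times> nat \<Rightarrow>
     (complex \<Rightarrow> times \<Rightarrow> complex) \<Rightarrow> complex \<Rightarrow> times \<Rightarrow> complex" where
  "lax_op Om A F p t = d_time A F p t - poisson (Om A) F p t"

(* Cross-differentiation of the linear system: the commutator of the operators of the system is
   the bracket with the curvature, i.e. the obstruction to compatibility is the left-hand side of
   the hierarchy equations. *)
definition lax_compatibility_on ::
    "(nat \<times> nat) set \<Rightarrow> (nat \<times> nat \<Rightarrow> complex \<Rightarrow> times \<Rightarrow> complex) \<Rightarrow> (complex \<times> times) set \<Rightarrow> bool"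
  where
  "lax_compatibility_on I Om U \<longleftrightarrow>
     (\<forall>A\<in>I. \<forall>B\<in>I. \<forall>V F. V \<subseteq> U \<and> slice_holomorphic I F V \<longrightarrow>
        (\<forall>(p, t)\<in>V.
           lax_op Om A (lax_op Om B F) p t - lax_op Om B (lax_op Om A F) p t
             = poisson (whitham_curvature Om A B) F p t))"

end

theory Submission
  imports Defs
begin

text \<open>
  Along the graph \<open>p = p(z, t)\<close> the hierarchy equations express the symmetry of the second
  derivatives of \<open>S\<close>, where \<open>\<partial>S/\<partial>x = p\<close>. This gives them only at the points of the graph, but for
  fixed \<open>t\<close> the first derivatives of all \<open>\<Omega>\<^sub>A\<close>, the logarithmic ones included, extend to holomorphic
  functions of \<open>p\<close> on the plane punctured at the \<open>q\<^sub>i(t)\<close>. The graph contains an open set of \<open>p\<close>, the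
  map \<open>z \<mapsto> p(z, t)\<close> being holomorphic and injective, and the punctured plane is connected, so the
  equations propagate to all \<open>p\<close>. The compatibility statement is the Jacobi identity.
\<close>

text \<open>The obstacle is the domain \<open>U\<close> of the branches of ln(p - q_i): its fibre
  over a fixed t may be disconnected, and the graph may meet only one component, so the hierarchy
  equations cannot be continued inside \<open>U\<close>. The way out is that the curvature contains
  first derivatives only. Those of ln(p - q_i) are the derivatives of p - q_i divided by p - q_i,
  the same for every branch and meaningful for all p other than q_i. The remaining Omega_A are
  polynomials in p or in 1/(p - q_i) whose coefficients are polynomials in finitely many Laurent
  coefficients of z_\<alpha>; so they are holomorphic far beyond the neighbourhood on which
  z_\<alpha> is defined.\<close>

notation fls_nth (infixl "$$" 75)

subsection \<open>Mixed partial derivatives\<close>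

text \<open>The Cauchy estimate for the second derivative makes the difference quotients in \<open>s\<close> converge
  uniformly in \<open>u\<close>, so their \<open>u\<close>-derivatives converge as well.\<close>

lemma mixed_derivative_limit:
  fixes h :: "complex \<times> complex \<Rightarrow> complex"
  assumes "open W" "(s0, u0) \<in> W"
    and hol: "\<And>y. y \<in> W \<Longrightarrow> \<exists>c d. (h has_derivative (\<lambda>k. c * fst k + d * snd k)) (at y)"
  obtains D where "((\<lambda>u. deriv (\<lambda>s. h (s, u)) s0) has_field_derivative D) (at u0)"
    "((\<lambda>\<delta>. (deriv (\<lambda>u. h (s0 + \<delta>, u)) u0 - deriv (\<lambda>u. h (s0, u)) u0) / \<delta>) \<longlongrightarrow> D) (at 0)"
proof -
  obtain A B where AB: "open A" "open B" "s0 \<in> A" "u0 \<in> B" "A \<times> B \<subseteq> W"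
    using open_prod_elim[OF assms(1,2)] by (metis mem_Sigma_iff)
  obtain r1 where r1: "r1 > 0" "cball s0 r1 \<subseteq> A" using AB open_contains_cball by blast
  obtain r2 where r2: "r2 > 0" "cball u0 r2 \<subseteq> B" using AB open_contains_cball by blast
  define R where "R = min r1 r2"
  have R: "R > 0" using r1 r2 by (simp add: R_def)
  have sub: "(s, u) \<in> W" if "s \<in> cball s0 R" "u \<in> cball u0 R" for s u
  proof -
    have "s \<in> A" "u \<in> B" using that r1(2) r2(2) by (auto simp: R_def)
    thus ?thesis using AB(5) by blast
  qed
  have ds: "(\<lambda>s. h (s, u)) field_differentiable (at s)" if su: "(s, u) \<in> W" for s u
  proof -
    obtain c d where D: "(h has_derivative (\<lambda>k. c * fst k + d * snd k)) (at (s, u))"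
      using hol[OF su] by blast
    have "((\<lambda>s. (s, u)) has_derivative (\<lambda>k. (k, 0))) (at s)"
      by (auto intro!: derivative_eq_intros)
    from has_derivative_compose[OF this D]
    have "((\<lambda>s. h (s, u)) has_derivative (\<lambda>k. c * k)) (at s)"
      by simp
    thus ?thesis by (auto simp: field_differentiable_def has_field_derivative_def)
  qed
  have du: "(\<lambda>u. h (s, u)) field_differentiable (at u)" if su: "(s, u) \<in> W" for s u
  proof -
    obtain c d where D: "(h has_derivative (\<lambda>k. c * fst k + d * snd k)) (at (s, u))"
      using hol[OF su] by blast
    have "((\<lambda>u. (s, u)) has_derivative (\<lambda>k. (0, k))) (at u)"
      by (auto intro!: derivative_eq_intros)
    from has_derivative_compose[OF this D]
    have "((\<lambda>u. h (s, u)) has_derivative (\<lambda>k. d * k)) (at u)"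
      by simp
    thus ?thesis by (auto simp: field_differentiable_def has_field_derivative_def)
  qed
  have "continuous_on (cball s0 R \<times> cball u0 R) h"
  proof (intro continuous_at_imp_continuous_on ballI)
    fix y assume "y \<in> cball s0 R \<times> cball u0 R"
    hence "y \<in> W" using sub by (cases y) auto
    thus "isCont h y" using hol has_derivative_continuous by blast
  qed
  hence "bounded (h ` (cball s0 R \<times> cball u0 R))"
    by (intro compact_imp_bounded compact_continuous_image compact_Times) auto
  then obtain M where M: "\<And>s u. s \<in> cball s0 R \<Longrightarrow> u \<in> cball u0 R \<Longrightarrow> norm (h (s, u)) \<le> M"
    by (force simp: bounded_iff)
  \<comment> \<open>Cauchy's estimate 2! M / (R/2)^2 for the second s-derivative at centres within
    R/2 of \<open>s0\<close>: the circle of radius R/2 about such a centre stays in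
    \<open>cball s0 R\<close>. The bound M, hence C, does not depend on u.\<close>
  define C where "C = 2 * M / (R/2)^2"
  have M0: "M \<ge> 0" using M[of s0 u0] R by (auto intro: order_trans[OF norm_ge_zero])
  have C0: "C \<ge> 0" using M0 by (simp add: C_def)
  have taylor: "norm (h (s0 + \<delta>, u) - h (s0, u) - deriv (\<lambda>s. h (s, u)) s0 * \<delta>) \<le> C * norm \<delta> ^ 2"
    if u: "u \<in> cball u0 R" and \<delta>: "norm \<delta> \<le> R / 2" for u \<delta>
  proof -
    define g where "g = (\<lambda>s. h (s, u))"
    have g: "g field_differentiable (at s)" if "s \<in> cball s0 R" for s
      unfolding g_def using ds sub that u by blast
    have hg: "g holomorphic_on ball s0 R"
      unfolding holomorphic_on_def by (intro ballI, rule field_differentiable_at_within, rule g) simp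
    have "norm ((deriv ^^ 2) g s) \<le> C" if s: "s \<in> cball s0 (R/2)" for s
    proof -
      have in_ball: "y \<in> cball s0 R" if "y \<in> cball s (R/2)" for y
        using that s dist_triangle[of s0 y s] by auto
      have "norm ((deriv ^^ 2) g s) \<le> fact 2 * M / (R/2)^2"
      proof (rule Cauchy_inequality)
        show "g holomorphic_on ball s (R/2)"
          unfolding holomorphic_on_def by (intro ballI, rule field_differentiable_at_within, rule g, rule in_ball) simp
        show "continuous_on (cball s (R/2)) g"
          by (intro continuous_at_imp_continuous_on ballI field_differentiable_imp_continuous_at g in_ball)
        show "norm (g y) \<le> M" if "norm (s - y) = R/2" for y
          using M[OF in_ball u, of y] that by (simp add: g_def dist_norm)
      qed (use R in auto)
      thus ?thesis by (simp add: C_def)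
    qed
    \<comment> \<open>First-order Taylor expansion on the convex disc of radius R/2. This form of
      the remainder divides by \<open>fact 1\<close>, not by \<open>fact 2\<close>, so C enters
      undivided.\<close>
    hence "cmod ((deriv ^^ 0) g (s0 + \<delta>) - (\<Sum>i\<le>1. (deriv ^^ i) g s0 * ((s0 + \<delta>) - s0) ^ i / (fact i)))
        \<le> C * cmod ((s0 + \<delta>) - s0) ^ (Suc 1) / fact 1"
    proof (intro complex_Taylor[of "cball s0 (R/2)"])
      fix i x assume x: "x \<in> cball s0 (R/2)"
      hence "(deriv ^^ i) g field_differentiable (at x)"
        using holomorphic_higher_deriv[OF hg, of i] R
        by (intro holomorphic_on_imp_differentiable_at[of _ "ball s0 R"]) auto
      thus "((deriv ^^ i) g has_field_derivative (deriv ^^ Suc i) g x) (at x within cball s0 (R / 2))"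
        by (auto simp: DERIV_deriv_iff_field_differentiable intro: has_field_derivative_at_within)
    qed (use R \<delta> in \<open>auto simp: dist_norm numeral_2_eq_2\<close>)
    thus ?thesis by (simp add: g_def algebra_simps power2_eq_square)
  qed
  define Q where "Q = (\<lambda>\<delta> u. (h (s0 + \<delta>, u) - h (s0, u)) / \<delta>)"
  have unif: "uniform_limit (cball u0 R) Q (\<lambda>u. deriv (\<lambda>s. h (s, u)) s0) (at 0)"
  proof (rule uniform_limitI)
    fix e :: real assume e: "e > 0"
    \<comment> \<open>C may be 0; the summand 1 keeps the quotient meaningful and makes the final
      inequality C * (e / (C + 1)) < e strict.\<close>
    define d where "d = min (R/2) (e / (C + 1))"
    have d: "d > 0" using R e C0 by (simp add: d_def)
    have "dist (Q \<delta> u) (deriv (\<lambda>s. h (s, u)) s0) < e"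
      if "\<delta> \<noteq> 0" "norm \<delta> < d" "u \<in> cball u0 R" for \<delta> u
    proof -
      have "dist (Q \<delta> u) (deriv (\<lambda>s. h (s, u)) s0)
          = norm (h (s0 + \<delta>, u) - h (s0, u) - deriv (\<lambda>s. h (s, u)) s0 * \<delta>) / norm \<delta>"
        using that by (simp add: Q_def dist_norm norm_divide [symmetric] field_simps)
      also have "\<dots> \<le> (C * norm \<delta> ^ 2) / norm \<delta>"
        using taylor[OF that(3), of \<delta>] that(2) by (intro divide_right_mono) (auto simp: d_def)
      also have "\<dots> = C * norm \<delta>" using that by (simp add: power2_eq_square)
      also have "\<dots> \<le> C * (e / (C + 1))"
        using that C0 by (intro mult_left_mono) (auto simp: d_def)
      also have "\<dots> < e" using C0 e by (simp add: field_simps)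
      finally show ?thesis .
    qed
    thus "\<forall>\<^sub>F \<delta> in at 0. \<forall>u\<in>cball u0 R. dist (Q \<delta> u) (deriv (\<lambda>s. h (s, u)) s0) < e"
      unfolding eventually_at using d by (intro exI[of _ d]) (auto simp: dist_norm)
  qed
  define Q' where "Q' = (\<lambda>\<delta> u. (deriv (\<lambda>u. h (s0 + \<delta>, u)) u - deriv (\<lambda>u. h (s0, u)) u) / \<delta>)"
  have dQ: "(Q \<delta> has_field_derivative Q' \<delta> u) (at u)"
    if "norm \<delta> < R" "\<delta> \<noteq> 0" "u \<in> cball u0 R" for \<delta> u
  proof -
    have "(\<lambda>u. h (s0 + \<delta>, u)) field_differentiable (at u)" "(\<lambda>u. h (s0, u)) field_differentiable (at u)"
      using that R by (auto intro!: du sub simp: dist_norm)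
    thus ?thesis
      unfolding Q_def Q'_def
      by (intro DERIV_cdivide DERIV_diff) (simp_all add: DERIV_deriv_iff_field_differentiable)
  qed
  have ev: "\<forall>\<^sub>F \<delta> in at 0. continuous_on (cball u0 R) (Q \<delta>) \<and>
      (\<forall>w\<in>ball u0 R. (Q \<delta> has_field_derivative Q' \<delta> w) (at w))"
    unfolding eventually_at
  proof (intro exI[of _ R] conjI ballI impI)
    fix \<delta> :: complex assume "\<delta> \<noteq> 0 \<and> dist \<delta> 0 < R"
    hence \<delta>: "norm \<delta> < R" "\<delta> \<noteq> 0" by auto
    show "continuous_on (cball u0 R) (Q \<delta>)"
      using dQ[OF \<delta>] by (intro continuous_at_imp_continuous_on ballI DERIV_isCont)
    show "(Q \<delta> has_field_derivative Q' \<delta> w) (at w)" if "w \<in> ball u0 R" for w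
      using dQ[OF \<delta>] that by simp
  qed (fact R)
  obtain g' where g': "\<And>w. w \<in> ball u0 R \<Longrightarrow>
      ((\<lambda>u. deriv (\<lambda>s. h (s, u)) s0) has_field_derivative (g' w)) (at w) \<and> ((\<lambda>\<delta>. Q' \<delta> w) \<longlongrightarrow> g' w) (at 0)"
    using has_complex_derivative_uniform_limit[OF ev unif _ R] by auto
  show ?thesis
    using g'[of u0] R by (intro that[of "g' u0"]) (auto simp: Q'_def)
qed

text \<open>The limit D of the difference quotients in s of the u-derivative is also the
  u-derivative of the s-derivative. Exchanging the variables shows that the s-derivative of the
  u-derivative exists, and uniqueness of limits identifies it with D.\<close>

lemma mixed_derivatives:
  fixes h :: "complex \<times> complex \<Rightarrow> complex"
  assumes W: "open W" "(s0, u0) \<in> W"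
    and hol: "\<And>y. y \<in> W \<Longrightarrow> \<exists>c d. (h has_derivative (\<lambda>k. c * fst k + d * snd k)) (at y)"
  obtains D where "((\<lambda>u. deriv (\<lambda>s. h (s, u)) s0) has_field_derivative D) (at u0)"
    "((\<lambda>s. deriv (\<lambda>u. h (s, u)) u0) has_field_derivative D) (at s0)"
proof -
  obtain D where D: "((\<lambda>u. deriv (\<lambda>s. h (s, u)) s0) has_field_derivative D) (at u0)"
    "((\<lambda>\<delta>. (deriv (\<lambda>u. h (s0 + \<delta>, u)) u0 - deriv (\<lambda>u. h (s0, u)) u0) / \<delta>) \<longlongrightarrow> D) (at 0)"
    by (rule mixed_derivative_limit[OF assms])
  have swap: "\<exists>c d. ((\<lambda>y. h (prod.swap y)) has_derivative (\<lambda>k. c * fst k + d * snd k)) (at y)"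
    if "y \<in> prod.swap ` W" for y
  proof -
    have "prod.swap y \<in> W" using that by auto
    from hol[OF this]
    obtain c d where D: "(h has_derivative (\<lambda>k. c * fst k + d * snd k)) (at (prod.swap y))"
      by blast
    have "(prod.swap has_derivative prod.swap) (at y)"
      unfolding prod.swap_def by (auto intro!: derivative_eq_intros)
    from has_derivative_compose[OF this D]
    have "((\<lambda>y. h (prod.swap y)) has_derivative (\<lambda>k. d * fst k + c * snd k)) (at y)"
      by (simp add: add.commute)
    thus ?thesis by blast
  qed
  have op: "open (prod.swap ` W)"
  proof -
    have "prod.swap ` W = prod.swap -` W" by force
    thus ?thesis using W(1)
      by (auto intro!: open_vimage continuous_intros simp: prod.swap_def)
  qed
  have "(u0, s0) \<in> prod.swap ` W" using W(2) by force
  from mixed_derivative_limit[OF op this swap]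
  obtain E where "((\<lambda>s. deriv (\<lambda>u. h (s, u)) u0) has_field_derivative E) (at s0)"
    by (simp add: prod.swap_def) metis
  moreover have "E = D"
    using calculation D(2) unfolding DERIV_def by (rule tendsto_unique[rotated]) simp
  ultimately show ?thesis using D that by blast
qed

subsection \<open>Holomorphy along coordinate planes\<close>

text \<open>Absolute coordinates instead of increments: x itself sits at \<open>(x v, x w)\<close>,
  and moving the base point within the plane does not change the map.\<close>

definition plane :: "'i \<Rightarrow> 'i \<Rightarrow> ('i \<Rightarrow> complex) \<Rightarrow> complex \<times> complex \<Rightarrow> ('i \<Rightarrow> complex)" where
  "plane v w x y = x(v := fst y, w := snd y)"

definition plane_open :: "'i set \<Rightarrow> ('i \<Rightarrow> complex) set \<Rightarrow> bool" where
  "plane_open K U \<longleftrightarrow> (\<forall>x\<in>U. \<forall>v\<in>K. \<forall>w\<in>K. v \<noteq> w \<longrightarrow> open {y. plane v w x y \<in> U})"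

text \<open>Everything below involves at most two variables at a time, so holomorphy along coordinate
  planes suffices, and the infinitely many times need no topology.\<close>

definition plane_holomorphic ::
    "'i set \<Rightarrow> (('i \<Rightarrow> complex) \<Rightarrow> complex) \<Rightarrow> ('i \<Rightarrow> complex) set \<Rightarrow> bool" where
  "plane_holomorphic K F U \<longleftrightarrow> plane_open K U \<and>
     (\<forall>x\<in>U. \<forall>v\<in>K. \<forall>w\<in>K. v \<noteq> w \<longrightarrow>
        (\<exists>c d. ((\<lambda>y. F (plane v w x y)) has_derivative (\<lambda>k. c * fst k + d * snd k)) (at (x v, x w))))"

definition pd :: "'i \<Rightarrow> (('i \<Rightarrow> complex) \<Rightarrow> complex) \<Rightarrow> ('i \<Rightarrow> complex) \<Rightarrow> complex" where
  "pd v F x = deriv (\<lambda>s. F (x(v := s))) (x v)"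

lemma plane_self [simp]: "plane v w x (x v, x w) = x"
  by (auto simp: plane_def)

lemma plane_line:
  "v \<noteq> w \<Longrightarrow> plane v w x (s, x w) = x(v := s)" "plane v w x (x v, s) = x(w := s)"
  by (auto simp: plane_def)

lemma plane_plane: "v \<noteq> w \<Longrightarrow> plane v w (plane v w x y) = plane v w x"
  by (auto simp: plane_def fun_eq_iff)

lemma plane_holomorphic_imp_plane_open: "plane_holomorphic K F U \<Longrightarrow> plane_open K U"
  by (simp add: plane_holomorphic_def)

lemma plane_openD:
  "plane_open K U \<Longrightarrow> x \<in> U \<Longrightarrow> v \<in> K \<Longrightarrow> w \<in> K \<Longrightarrow> v \<noteq> w \<Longrightarrow> open {y. plane v w x y \<in> U}"
  by (auto simp: plane_open_def)

lemma plane_open_eventually: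
  assumes "plane_open K U" "x \<in> U" "v \<in> K" "w \<in> K" "v \<noteq> w"
  shows "\<forall>\<^sub>F y in nhds (x v, x w). plane v w x y \<in> U"
  using eventually_nhds_in_open[OF plane_openD[OF assms], of "(x v, x w)"] assms(2) by simp

text \<open>Every point of a plane is a base point of the same plane, by \<open>plane_plane\<close>,
  so neighbourhoods of the base point suffice.\<close>

lemma plane_openI:
  assumes "\<And>x v w. x \<in> U \<Longrightarrow> v \<in> K \<Longrightarrow> w \<in> K \<Longrightarrow> v \<noteq> w \<Longrightarrow>
    \<forall>\<^sub>F y in nhds (x v, x w). plane v w x y \<in> U"
  shows "plane_open K U"
  unfolding plane_open_def
proof (intro ballI impI)
  fix x v w assume *: "x \<in> U" "v \<in> K" "w \<in> K" "v \<noteq> w"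
  show "open {y. plane v w x y \<in> U}"
  proof (subst open_subopen, safe)
    fix a b assume "plane v w x (a, b) \<in> U"
    from assms[OF this *(2-4)] *(4) have "\<forall>\<^sub>F y in nhds (a, b). plane v w x y \<in> U"
      by (simp add: plane_plane) (simp add: plane_def)
    thus "\<exists>T. open T \<and> (a, b) \<in> T \<and> T \<subseteq> {y. plane v w x y \<in> U}"
      unfolding eventually_nhds by blast
  qed
qed

lemma plane_holomorphicE:
  assumes "plane_holomorphic K F U" "x \<in> U" "v \<in> K" "w \<in> K" "v \<noteq> w"
  obtains c d where
    "((\<lambda>y. F (plane v w x y)) has_derivative (\<lambda>k. c * fst k + d * snd k)) (at (x v, x w))"
  using assms unfolding plane_holomorphic_def by blast

lemma plane_holomorphicI:
  assumes "plane_open K U"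
    and "\<And>x v w. x \<in> U \<Longrightarrow> v \<in> K \<Longrightarrow> w \<in> K \<Longrightarrow> v \<noteq> w \<Longrightarrow>
      \<exists>c d. ((\<lambda>y. F (plane v w x y)) has_derivative (\<lambda>k. c * fst k + d * snd k)) (at (x v, x w))"
  shows "plane_holomorphic K F U"
  using assms by (auto simp: plane_holomorphic_def)

lemma plane_holomorphic_mono:
  "plane_holomorphic K F U \<Longrightarrow> V \<subseteq> U \<Longrightarrow> plane_open K V \<Longrightarrow> plane_holomorphic K F V"
  by (auto simp: plane_holomorphic_def)

lemma plane_holomorphic_cong:
  assumes "plane_holomorphic K F U" "\<And>x. x \<in> U \<Longrightarrow> F x = G x"
  shows "plane_holomorphic K G U"
proof (rule plane_holomorphicI)
  show op: "plane_open K U" using assms(1) by (rule plane_holomorphic_imp_plane_open)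
  fix x v w assume *: "x \<in> U" "v \<in> K" "w \<in> K" "v \<noteq> w"
  obtain c d where "((\<lambda>y. F (plane v w x y)) has_derivative (\<lambda>k. c * fst k + d * snd k)) (at (x v, x w))"
    using plane_holomorphicE[OF assms(1) *] .
  hence "((\<lambda>y. G (plane v w x y)) has_derivative (\<lambda>k. c * fst k + d * snd k)) (at (x v, x w))"
    by (rule has_derivative_transform_within_open[OF _ plane_openD[OF op *]]) (use assms(2) * in auto)
  thus "\<exists>c d. ((\<lambda>y. G (plane v w x y)) has_derivative (\<lambda>k. c * fst k + d * snd k)) (at (x v, x w))"
    by blast
qed

lemma plane_holomorphic_const: "plane_open K U \<Longrightarrow> plane_holomorphic K (\<lambda>_. c) U"
  by (rule plane_holomorphicI) (auto intro!: exI[of _ 0])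

lemma plane_holomorphic_coordinate:
  fixes i :: 'i
  assumes "plane_open K U"
  shows "plane_holomorphic K (\<lambda>x. x i) U"
proof (rule plane_holomorphicI)
  fix x :: "'i \<Rightarrow> complex" and v w :: 'i assume "v \<noteq> w"
  thus "\<exists>c d. ((\<lambda>y. plane v w x y i) has_derivative (\<lambda>k. c * fst k + d * snd k)) (at (x v, x w))"
    by (intro exI[of _ "if i = v then 1 else 0"] exI[of _ "if i = w then 1 else 0"])
      (auto simp: plane_def intro!: derivative_eq_intros)
qed (fact assms)

lemma plane_holomorphic_add:
  assumes "plane_holomorphic K F U" "plane_holomorphic K G U"
  shows "plane_holomorphic K (\<lambda>x. F x + G x) U"
proof (rule plane_holomorphicI)
  show "plane_open K U" using assms(1) by (rule plane_holomorphic_imp_plane_open)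
  fix x v w assume *: "x \<in> U" "v \<in> K" "w \<in> K" "v \<noteq> w"
  obtain c d where F: "((\<lambda>y. F (plane v w x y)) has_derivative (\<lambda>k. c * fst k + d * snd k)) (at (x v, x w))"
    using plane_holomorphicE[OF assms(1) *] .
  obtain c' d' where G: "((\<lambda>y. G (plane v w x y)) has_derivative (\<lambda>k. c' * fst k + d' * snd k)) (at (x v, x w))"
    using plane_holomorphicE[OF assms(2) *] .
  show "\<exists>c d. ((\<lambda>y. F (plane v w x y) + G (plane v w x y)) has_derivative (\<lambda>k. c * fst k + d * snd k))
      (at (x v, x w))"
    by (rule exI[of _ "c + c'"], rule exI[of _ "d + d'"],
        rule has_derivative_eq_rhs[OF has_derivative_add[OF F G]]) (simp add: algebra_simps)
qed

lemma plane_holomorphic_mult: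
  assumes "plane_holomorphic K F U" "plane_holomorphic K G U"
  shows "plane_holomorphic K (\<lambda>x. F x * G x) U"
proof (rule plane_holomorphicI)
  show "plane_open K U" using assms(1) by (rule plane_holomorphic_imp_plane_open)
  fix x v w assume *: "x \<in> U" "v \<in> K" "w \<in> K" "v \<noteq> w"
  obtain c d where F: "((\<lambda>y. F (plane v w x y)) has_derivative (\<lambda>k. c * fst k + d * snd k)) (at (x v, x w))"
    using plane_holomorphicE[OF assms(1) *] .
  obtain c' d' where G: "((\<lambda>y. G (plane v w x y)) has_derivative (\<lambda>k. c' * fst k + d' * snd k)) (at (x v, x w))"
    using plane_holomorphicE[OF assms(2) *] .
  show "\<exists>c d. ((\<lambda>y. F (plane v w x y) * G (plane v w x y)) has_derivative (\<lambda>k. c * fst k + d * snd k))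
      (at (x v, x w))"
    by (rule exI[of _ "F x * c' + c * G x"], rule exI[of _ "F x * d' + d * G x"],
        rule has_derivative_eq_rhs[OF has_derivative_mult[OF F G]]) (simp add: algebra_simps)
qed

lemma plane_holomorphic_inverse:
  assumes "plane_holomorphic K F U" "\<And>x. x \<in> U \<Longrightarrow> F x \<noteq> 0"
  shows "plane_holomorphic K (\<lambda>x. inverse (F x)) U"
proof (rule plane_holomorphicI)
  show "plane_open K U" using assms(1) by (rule plane_holomorphic_imp_plane_open)
  fix x v w assume *: "x \<in> U" "v \<in> K" "w \<in> K" "v \<noteq> w"
  obtain c d where F: "((\<lambda>y. F (plane v w x y)) has_derivative (\<lambda>k. c * fst k + d * snd k)) (at (x v, x w))"
    using plane_holomorphicE[OF assms(1) *] .
  have nz: "F (plane v w x (x v, x w)) \<noteq> 0" using assms(2)[OF *(1)] by simp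
  show "\<exists>c d. ((\<lambda>y. inverse (F (plane v w x y))) has_derivative (\<lambda>k. c * fst k + d * snd k))
      (at (x v, x w))"
    by (rule exI[of _ "- (inverse (F x) * c * inverse (F x))"],
        rule exI[of _ "- (inverse (F x) * d * inverse (F x))"],
        rule has_derivative_eq_rhs[OF Deriv.has_derivative_inverse[OF nz F]]) (simp add: algebra_simps)
qed

lemma plane_holomorphic_uminus:
  assumes "plane_holomorphic K F U"
  shows "plane_holomorphic K (\<lambda>x. - F x) U"
  using plane_holomorphic_mult[OF plane_holomorphic_const[of K U "-1"] assms]
    plane_holomorphic_imp_plane_open[OF assms] by simp

lemma plane_holomorphic_diff:
  assumes "plane_holomorphic K F U" "plane_holomorphic K G U"
  shows "plane_holomorphic K (\<lambda>x. F x - G x) U"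
  using plane_holomorphic_add[OF assms(1) plane_holomorphic_uminus[OF assms(2)]] by simp

lemma plane_holomorphic_power:
  assumes "plane_holomorphic K F U"
  shows "plane_holomorphic K (\<lambda>x. F x ^ n) U"
  by (induction n)
    (simp_all add: plane_holomorphic_mult assms plane_holomorphic_const plane_holomorphic_imp_plane_open[OF assms])

lemma plane_holomorphic_sum:
  assumes "plane_open K U" "\<And>i. i \<in> A \<Longrightarrow> plane_holomorphic K (F i) U"
  shows "plane_holomorphic K (\<lambda>x. \<Sum>i\<in>A. F i x) U"
  using assms
  by (induction A rule: infinite_finite_induct) (simp_all add: plane_holomorphic_add plane_holomorphic_const)

lemma plane_holomorphic_prod:
  assumes "plane_open K U" "\<And>i. i \<in> A \<Longrightarrow> plane_holomorphic K (F i) U"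
  shows "plane_holomorphic K (\<lambda>x. \<Prod>i\<in>A. F i x) U"
  using assms
  by (induction A rule: infinite_finite_induct) (simp_all add: plane_holomorphic_mult plane_holomorphic_const)

text \<open>Differentiability along planes gives continuity along planes. With F the product of all
  p - q_i this makes the family of punctured p-planes open.\<close>

lemma plane_open_nonzero:
  assumes "plane_holomorphic K F U"
  shows "plane_open K {x \<in> U. F x \<noteq> 0}"
proof (rule plane_openI)
  fix x v w assume "x \<in> {x \<in> U. F x \<noteq> 0}" and *: "v \<in> K" "w \<in> K" "v \<noteq> w"
  hence x: "x \<in> U" "F x \<noteq> 0" by auto
  obtain c d where "((\<lambda>y. F (plane v w x y)) has_derivative (\<lambda>k. c * fst k + d * snd k)) (at (x v, x w))"
    using plane_holomorphicE[OF assms x(1) *] .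
  hence "isCont (\<lambda>y. F (plane v w x y)) (x v, x w)" by (rule has_derivative_continuous)
  hence "((\<lambda>y. F (plane v w x y)) \<longlongrightarrow> F (plane v w x (x v, x w))) (nhds (x v, x w))"
    unfolding isCont_def
    by (rule tendsto_at_iff_tendsto_nhds[of "\<lambda>y. F (plane v w x y)" "(x v, x w)", THEN iffD1])
  hence "\<forall>\<^sub>F y in nhds (x v, x w). F (plane v w x y) \<noteq> 0"
    by (rule tendsto_imp_eventually_ne) (use x(2) in simp)
  with plane_open_eventually[OF plane_holomorphic_imp_plane_open[OF assms] x(1) *]
  show "\<forall>\<^sub>F y in nhds (x v, x w). plane v w x y \<in> {x \<in> U. F x \<noteq> 0}"
    by eventually_elim auto
qed

text \<open>Statements on one direction carry a second one because \<^const>\<open>plane_holomorphic\<close> is void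
  when \<open>K\<close> is a singleton.\<close>

lemma plane_holomorphic_has_derivative:
  assumes "plane_holomorphic K F U" "x \<in> U" "v \<in> K" "w \<in> K" "v \<noteq> w"
  shows "((\<lambda>y. F (plane v w x y)) has_derivative (\<lambda>k. pd v F x * fst k + pd w F x * snd k)) (at (x v, x w))"
proof -
  obtain c d where D: "((\<lambda>y. F (plane v w x y)) has_derivative (\<lambda>k. c * fst k + d * snd k)) (at (x v, x w))"
    using plane_holomorphicE[OF assms] .
  have "((\<lambda>s. (s, x w)) has_derivative (\<lambda>k. (k, 0))) (at (x v))"
    by (auto intro!: derivative_eq_intros)
  from has_derivative_compose[OF this D]
  have "((\<lambda>s. F (x(v := s))) has_field_derivative c) (at (x v))"
    using assms(5) by (simp add: has_field_derivative_def plane_line)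
  hence c: "pd v F x = c" by (auto simp: pd_def DERIV_imp_deriv)
  have "((\<lambda>s. (x v, s)) has_derivative (\<lambda>k. (0, k))) (at (x w))"
    by (auto intro!: derivative_eq_intros)
  from has_derivative_compose[OF this D]
  have "((\<lambda>s. F (x(w := s))) has_field_derivative d) (at (x w))"
    by (simp add: has_field_derivative_def plane_line)
  hence d: "pd w F x = d" by (auto simp: pd_def DERIV_imp_deriv)
  show ?thesis using D by (simp add: c d)
qed

lemma plane_holomorphic_DERIV:
  assumes "plane_holomorphic K F U" "x \<in> U" "v \<in> K" "w \<in> K" "v \<noteq> w"
  shows "((\<lambda>s. F (x(v := s))) has_field_derivative pd v F x) (at (x v))"
proof -
  have "((\<lambda>s. (s, x w)) has_derivative (\<lambda>k. (k, 0))) (at (x v))"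
    by (auto intro!: derivative_eq_intros)
  from has_derivative_compose[OF this plane_holomorphic_has_derivative[OF assms]]
  show ?thesis
    using assms(5) by (simp add: has_field_derivative_def plane_line)
qed

lemma plane_open_line:
  assumes "plane_open K U" "x \<in> U" "v \<in> K" "w \<in> K" "v \<noteq> w"
  shows "open {s. x(v := s) \<in> U}"
proof -
  have "open ((\<lambda>s. (s, x w)) -` {y. plane v w x y \<in> U})"
    by (intro open_vimage plane_openD[OF assms] continuous_intros)
  also have "(\<lambda>s. (s, x w)) -` {y. plane v w x y \<in> U} = {s. x(v := s) \<in> U}"
    using assms(5) by (auto simp: plane_line)
  finally show ?thesis .
qed

lemma plane_holomorphic_line:
  assumes "plane_holomorphic K F U" "v \<in> K" "w \<in> K" "v \<noteq> w"
  shows "(\<lambda>s. F (x(v := s))) holomorphic_on {s. x(v := s) \<in> U}"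
  unfolding holomorphic_on_def
proof safe
  fix s assume "x(v := s) \<in> U"
  from plane_holomorphic_DERIV[OF assms(1) this assms(2-4)]
  have "(\<lambda>s. F (x(v := s))) field_differentiable (at s)"
    by (auto simp: field_differentiable_def)
  thus "(\<lambda>s. F (x(v := s))) field_differentiable (at s within {s. x(v := s) \<in> U})"
    by (rule field_differentiable_at_within)
qed

lemma plane_holomorphic_mixed:
  assumes F: "plane_holomorphic K F U" "x \<in> U" "v \<in> K" "w \<in> K" "v \<noteq> w"
  obtains D where "((\<lambda>s. pd v F (x(w := s))) has_field_derivative D) (at (x w))"
    "((\<lambda>s. pd w F (x(v := s))) has_field_derivative D) (at (x v))"
proof -
  have mem: "(x v, x w) \<in> {y. plane v w x y \<in> U}" using F by simp
  have hol: "\<exists>c d. ((\<lambda>y. F (plane v w x y)) has_derivative (\<lambda>k. c * fst k + d * snd k)) (at y)"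
    if y: "y \<in> {y. plane v w x y \<in> U}" for y
  proof -
    obtain c d where "((\<lambda>y'. F (plane v w (plane v w x y) y')) has_derivative (\<lambda>k. c * fst k + d * snd k))
      (at (plane v w x y v, plane v w x y w))"
      by (rule plane_holomorphicE[OF F(1) _ F(3-5)]) (use y in auto)
    moreover have "(plane v w x y v, plane v w x y w) = y" using F(5) by (simp add: plane_def)
    ultimately show ?thesis using F(5) by (auto simp: plane_plane)
  qed
  obtain D where
    "((\<lambda>u. deriv (\<lambda>s. F (plane v w x (s, u))) (x v)) has_field_derivative D) (at (x w))"
    "((\<lambda>s. deriv (\<lambda>u. F (plane v w x (s, u))) (x w)) has_field_derivative D) (at (x v))"
    by (rule mixed_derivatives[OF plane_openD[OF plane_holomorphic_imp_plane_open[OF F(1)] F(2-5)] mem hol])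
  moreover have "x(w := u, v := s) = plane v w x (s, u)" "x(v := s, w := u) = plane v w x (s, u)" for s u
    using F(5) by (auto simp: plane_def)
  ultimately show ?thesis
    using F(5) by (intro that[of D]) (simp_all add: pd_def)
qed

text \<open>Two different reasons: for v = w the derivative of a holomorphic function of one
  variable is holomorphic, for distinct directions the mixed derivative exists. This allows
  expressions in first derivatives to be differentiated once more without proving that
  \<open>pd v F\<close> is itself holomorphic along planes.\<close>

lemma plane_holomorphic_DERIV_pd:
  assumes F: "plane_holomorphic K F U" "x \<in> U" "v \<in> K" "w \<in> K" and K: "\<exists>u\<in>K. u \<noteq> v"
  shows "((\<lambda>s. pd v F (x(w := s))) has_field_derivative pd w (pd v F) x) (at (x w))"
proof (cases "v = w")
  case True
  obtain u where u: "u \<in> K" "u \<noteq> v" using K by blast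
  have "deriv (\<lambda>s. F (x(v := s))) holomorphic_on {s. x(v := s) \<in> U}"
    using u F by (intro holomorphic_deriv plane_holomorphic_line[OF F(1,3) u(1)]
        plane_open_line[OF plane_holomorphic_imp_plane_open[OF F(1)] F(2,3) u(1)]) auto
  hence "deriv (\<lambda>s. F (x(v := s))) field_differentiable (at (x v))"
    using u F by (intro holomorphic_on_imp_differentiable_at[of _ "{s. x(v := s) \<in> U}"]
        plane_open_line[OF plane_holomorphic_imp_plane_open[OF F(1)] F(2,3) u(1)]) auto
  thus ?thesis
    using True by (simp add: pd_def[abs_def] DERIV_deriv_iff_field_differentiable)
next
  case False
  obtain D where D: "((\<lambda>s. pd v F (x(w := s))) has_field_derivative D) (at (x w))"
    by (rule plane_holomorphic_mixed[OF F False])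
  moreover have "pd w (pd v F) x = D" using D by (simp add: pd_def[of w] DERIV_imp_deriv)
  ultimately show ?thesis by simp
qed

lemma pd_commute:
  assumes F: "plane_holomorphic K F U" "x \<in> U" "v \<in> K" "w \<in> K"
  shows "pd w (pd v F) x = pd v (pd w F) x"
proof (cases "v = w")
  case False
  obtain D where D: "((\<lambda>s. pd v F (x(w := s))) has_field_derivative D) (at (x w))"
    "((\<lambda>s. pd w F (x(v := s))) has_field_derivative D) (at (x v))"
    by (rule plane_holomorphic_mixed[OF F False])
  moreover have "pd w (pd v F) x = D" using D by (simp add: pd_def[of w] DERIV_imp_deriv)
  moreover have "pd v (pd w F) x = D" using D by (simp add: pd_def[of v] DERIV_imp_deriv)
  ultimately show ?thesis by simp
qed auto

lemma pd_cong_plane_open: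
  assumes "plane_open K U" "x \<in> U" "v \<in> K" "w \<in> K" "v \<noteq> w" "\<And>y. y \<in> U \<Longrightarrow> F y = G y"
  shows "pd v F x = pd v G x"
  unfolding pd_def
proof (rule deriv_cong_ev)
  show "\<forall>\<^sub>F s in nhds (x v). F (x(v := s)) = G (x(v := s))"
    using eventually_nhds_in_open[OF plane_open_line[OF assms(1-5)], of "x v"] assms(2,6)
    by (auto elim: eventually_mono)
qed simp

lemma pd_line_holomorphic:
  assumes "plane_holomorphic K F W" "u \<in> K" "P \<in> K" "\<exists>w\<in>K. w \<noteq> u"
  shows "(\<lambda>s. pd u F (x(P := s))) holomorphic_on {s. x(P := s) \<in> W}"
  unfolding holomorphic_on_def
proof safe
  fix s assume "x(P := s) \<in> W"
  from plane_holomorphic_DERIV_pd[OF assms(1) this assms(2-4)]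
  have "(\<lambda>s. pd u F (x(P := s))) field_differentiable (at s)"
    by (auto simp: field_differentiable_def)
  thus "(\<lambda>s. pd u F (x(P := s))) field_differentiable (at s within {s. x(P := s) \<in> W})"
    by (rule field_differentiable_at_within)
qed

text \<open>Differentiate exp l = g. The right-hand side does not depend on the branch and makes
  sense wherever g is nonzero, also off the domain of l.\<close>

lemma pd_branch_of_log:
  assumes "plane_holomorphic K l U" "x \<in> U" "v \<in> K" "w \<in> K" "v \<noteq> w"
    and "\<And>x. x \<in> U \<Longrightarrow> exp (l x) = g x"
  shows "pd v l x = pd v g x / g x"
proof -
  have "((\<lambda>s. l (x(v := s))) has_field_derivative pd v l x) (at (x v))"
    by (rule plane_holomorphic_DERIV[OF assms(1-5)])
  hence "((\<lambda>s. exp (l (x(v := s)))) has_field_derivative exp (l x) * pd v l x) (at (x v))"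
    by (auto intro!: derivative_eq_intros)
  hence "pd v (\<lambda>x. exp (l x)) x = g x * pd v l x"
    using assms(2,6) by (simp add: pd_def[of v "\<lambda>x. exp (l x)"] DERIV_imp_deriv)
  moreover have "pd v (\<lambda>x. exp (l x)) x = pd v g x"
    by (rule pd_cong_plane_open[OF plane_holomorphic_imp_plane_open[OF assms(1)] assms(2-6)])
  moreover have "g x \<noteq> 0" using assms(6)[OF assms(2)] exp_not_eq_zero by metis
  ultimately show ?thesis by (simp add: field_simps)
qed

subsection \<open>Curvature and Lax operators\<close>

text \<open>Coordinate versions of \<open>poisson\<close>, \<open>lax_op\<close> and
  \<open>whitham_curvature\<close>: P is the spectral direction, X the direction of x = t_(1,1), and
  a, b are the functions that drive the flows v, w. They are separate arguments because the
  commutator identity holds for arbitrary a and b.\<close>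

definition bracket where
  "bracket P X F G x = pd P F x * pd X G x - pd X F x * pd P G x"

definition lax where
  "lax P X v a F x = pd v F x - bracket P X a F x"

definition curvature where
  "curvature P X v w a b x = pd w a x - pd v b x + bracket P X a b x"

lemma pd_lax:
  assumes "plane_holomorphic K b V" "plane_holomorphic K F V" "x \<in> V"
    and K: "P \<in> K" "X \<in> K" "P \<noteq> X" "v \<in> K" "w \<in> K"
  shows "pd w (lax P X v b F) x = pd w (pd v F) x
    - (pd w (pd P b) x * pd X F x + pd w (pd X F) x * pd P b x
       - (pd w (pd X b) x * pd P F x + pd w (pd P F) x * pd X b x))"
proof -
  have K': "\<exists>u\<in>K. u \<noteq> v'" for v' using K by metis
  have D: "((\<lambda>s. pd v' G (x(w := s))) has_field_derivative pd w (pd v' G) x) (at (x w))"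
    if "plane_holomorphic K G V" "v' \<in> K" for v' G
    using plane_holomorphic_DERIV_pd[OF that(1) assms(3) that(2) K(5) K'] .
  have "((\<lambda>s. lax P X v b F (x(w := s))) has_field_derivative
      (pd w (pd v F) x - (pd w (pd P b) x * pd X F (x(w := x w)) + pd w (pd X F) x * pd P b (x(w := x w))
       - (pd w (pd X b) x * pd P F (x(w := x w)) + pd w (pd P F) x * pd X b (x(w := x w)))))) (at (x w))"
    unfolding lax_def bracket_def using assms
    by (intro DERIV_diff DERIV_mult D) auto
  thus ?thesis unfolding pd_def[of w "lax P X v b F"] by (simp add: DERIV_imp_deriv)
qed

lemma pd_curvature:
  assumes "plane_holomorphic K a V" "plane_holomorphic K b V" "x \<in> V"
    and K: "P \<in> K" "X \<in> K" "P \<noteq> X" "v \<in> K" "w \<in> K" "u \<in> K"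
  shows "pd u (curvature P X v w a b) x = pd u (pd w a) x - pd u (pd v b) x
    + (pd u (pd P a) x * pd X b x + pd u (pd X b) x * pd P a x
       - (pd u (pd X a) x * pd P b x + pd u (pd P b) x * pd X a x))"
proof -
  have K': "\<exists>u\<in>K. u \<noteq> v'" for v' using K by metis
  have D: "((\<lambda>s. pd v' G (x(u := s))) has_field_derivative pd u (pd v' G) x) (at (x u))"
    if "plane_holomorphic K G V" "v' \<in> K" for v' G
    using plane_holomorphic_DERIV_pd[OF that(1) assms(3) that(2) K(6) K'] .
  have "((\<lambda>s. curvature P X v w a b (x(u := s))) has_field_derivative
      (pd u (pd w a) x - pd u (pd v b) x
    + (pd u (pd P a) x * pd X b (x(u := x u)) + pd u (pd X b) x * pd P a (x(u := x u))
       - (pd u (pd X a) x * pd P b (x(u := x u)) + pd u (pd P b) x * pd X a (x(u := x u)))))) (at (x u))"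
    unfolding curvature_def bracket_def using assms
    by (intro DERIV_diff DERIV_add DERIV_mult D) auto
  thus ?thesis unfolding pd_def[of u "curvature P X v w a b"] by (simp add: DERIV_imp_deriv)
qed

text \<open>This is the Jacobi identity for \<^const>\<open>bracket\<close> together with the commutation of partial derivatives.\<close>

lemma lax_commutator:
  assumes hol: "plane_holomorphic K a V" "plane_holomorphic K b V" "plane_holomorphic K F V"
    and x: "x \<in> V" and K: "P \<in> K" "X \<in> K" "P \<noteq> X" "v \<in> K" "w \<in> K"
  shows "lax P X v a (lax P X w b F) x - lax P X w b (lax P X v a F) x
    = bracket P X (curvature P X v w a b) F x"
proof -
  note pdl = pd_lax[OF hol(2,3) x K(1-3,5)] pd_lax[OF hol(1,3) x K(1-4)]
    pd_curvature[OF hol(1,2) x K]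
  \<comment> \<open>The equations are oriented to bring P outermost, then X, then w. Each mixed
    derivative thus has one normal form, and what remains is a polynomial identity.\<close>
  have comm: "pd v (pd w F) x = pd w (pd v F) x" "pd v (pd P F) x = pd P (pd v F) x"
    "pd w (pd P F) x = pd P (pd w F) x" "pd v (pd X F) x = pd X (pd v F) x"
    "pd w (pd X F) x = pd X (pd w F) x" "pd X (pd P F) x = pd P (pd X F) x"
    by (rule pd_commute[OF hol(3) x]; use K in simp)+
  have comm_b: "pd v (pd P b) x = pd P (pd v b) x" "pd v (pd X b) x = pd X (pd v b) x"
    "pd X (pd P b) x = pd P (pd X b) x"
    by (rule pd_commute[OF hol(2) x]; use K in simp)+
  have comm_a: "pd w (pd P a) x = pd P (pd w a) x" "pd w (pd X a) x = pd X (pd w a) x"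
    "pd X (pd P a) x = pd P (pd X a) x"
    by (rule pd_commute[OF hol(1) x]; use K in simp)+
  show ?thesis
    unfolding lax_def[of P X v a "lax P X w b F"] lax_def[of P X w b "lax P X v a F"]
      bracket_def[of P X a "lax P X w b F"] bracket_def[of P X b "lax P X v a F"]
      bracket_def[of P X "curvature P X v w a b"]
    by (simp only: pdl K comm comm_a comm_b) algebra
qed

text \<open>Since \<open>\<partial>\<^sub>X S = pinv\<close>, symmetry of the second derivatives of \<open>S\<close> in \<open>X\<close> and \<open>v\<close> evaluates
  \<open>\<partial>\<^sub>v pinv\<close>; substituting this into the symmetry in \<open>v\<close> and \<open>w\<close> gives the claim.\<close>

lemma curvature_on_graph:
  fixes Om :: "'i \<Rightarrow> ('i \<Rightarrow> complex) \<Rightarrow> complex"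
  assumes P: "P \<notin> J" and X: "X \<in> J" and K: "K = insert P J"
    and Om: "\<And>v. v \<in> J \<Longrightarrow> plane_holomorphic K (Om v) U"
    and OmX: "\<And>x. x \<in> U \<Longrightarrow> Om X x = x P"
    and S: "plane_holomorphic K S G" and pinv: "plane_holomorphic K pinv G"
    and pinv_in: "\<And>x. x \<in> G \<Longrightarrow> x(P := pinv x) \<in> U"
    and dS: "\<And>v x. v \<in> J \<Longrightarrow> x \<in> G \<Longrightarrow> pd v S x = Om v (x(P := pinv x))"
    and x: "x \<in> G" and v: "v \<in> J" and w: "w \<in> J"
  shows "curvature P X v w (Om v) (Om w) (x(P := pinv x)) = 0"
proof -
  \<comment> \<open>The coordinate P holds the value of z at points of G and the value of p at
    points of U; this update passes from the first to the second.\<close>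
  define y where "y = x(P := pinv x)"
  have y: "y \<in> U" using pinv_in x by (simp add: y_def)
  have PX: "P \<noteq> X" "P \<in> K" "X \<in> K" using P X K by auto
  have second: "pd w (pd v S) x = pd P (Om v) y * pd w pinv x + pd w (Om v) y"
    if v: "v \<in> J" and w: "w \<in> J" for v w
  proof -
    have wP: "w \<noteq> P" "P \<noteq> w" "w \<in> K" using P w K by auto
    have "((\<lambda>s. pinv (x(w := s))) has_field_derivative pd w pinv x) (at (x w))"
      using plane_holomorphic_DERIV[OF pinv x wP(3) PX(2) wP(1)] .
    hence "((\<lambda>s. (pinv (x(w := s)), s)) has_derivative (\<lambda>k. (pd w pinv x * k, k))) (at (x w))"
      by (auto simp: has_field_derivative_def intro!: derivative_eq_intros)
    moreover have "((\<lambda>z. Om v (plane P w y z)) has_derivative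
        (\<lambda>k. pd P (Om v) y * fst k + pd w (Om v) y * snd k)) (at (pinv (x(w := x w)), x w))"
      using plane_holomorphic_has_derivative[OF Om[OF v] y PX(2) wP(3,2)] wP by (simp add: y_def)
    ultimately have "((\<lambda>s. Om v (plane P w y (pinv (x(w := s)), s))) has_derivative
        (\<lambda>k. pd P (Om v) y * (pd w pinv x * k) + pd w (Om v) y * k)) (at (x w))"
      using has_derivative_compose[of "\<lambda>s. (pinv (x(w := s)), s)"] by fastforce
    hence D: "((\<lambda>s. Om v (plane P w y (pinv (x(w := s)), s))) has_field_derivative
        (pd P (Om v) y * pd w pinv x + pd w (Om v) y)) (at (x w))"
      unfolding has_field_derivative_def
      by (rule has_derivative_eq_rhs) (auto simp: fun_eq_iff algebra_simps)
    have "((\<lambda>s. pd v S (x(w := s))) has_field_derivative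
        (pd P (Om v) y * pd w pinv x + pd w (Om v) y)) (at (x w))"
    proof (rule has_field_derivative_transform_within_open[OF D])
      show "open {s. x(w := s) \<in> G}"
        using plane_open_line[OF plane_holomorphic_imp_plane_open[OF S] x wP(3) PX(2) wP(1)] .
      show "Om v (plane P w y (pinv (x(w := s)), s)) = pd v S (x(w := s))" if "s \<in> {s. x(w := s) \<in> G}" for s
      proof -
        have "plane P w y (pinv (x(w := s)), s) = (x(w := s))(P := pinv (x(w := s)))"
          using wP by (auto simp: plane_def y_def)
        thus ?thesis using dS[OF v, of "x(w := s)"] that by simp
      qed
    qed (use x in simp)
    thus ?thesis by (simp add: pd_def[of w] DERIV_imp_deriv)
  qed
  have pdX: "pd u (Om X) y = (if u = P then 1 else 0)" if u: "u \<in> K" for u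
  proof -
    obtain u' where u': "u' \<in> K" "u \<noteq> u'" using PX by metis
    have "pd u (Om X) y = pd u (\<lambda>x. x P) y"
      by (rule pd_cong_plane_open[OF plane_holomorphic_imp_plane_open[OF Om[OF X]] y u u' OmX])
    thus ?thesis by (auto simp: pd_def)
  qed
  have pinv_v: "pd v pinv x = pd P (Om v) y * pd X pinv x + pd X (Om v) y" if v: "v \<in> J" for v
  proof -
    have "v \<in> K" "v \<noteq> P" using v K P by auto
    hence "pd v pinv x = pd v (pd X S) x"
      using second[OF X v] pdX PX by simp
    also have "\<dots> = pd X (pd v S) x"
      using pd_commute[OF S x, of X v] PX v K by simp
    finally show ?thesis using second[OF v X] by simp
  qed
  have "pd w (pd v S) x = pd v (pd w S) x"
    using pd_commute[OF S x, of v w] v w K by simp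
  hence "pd P (Om v) y * pd w pinv x + pd w (Om v) y = pd P (Om w) y * pd v pinv x + pd v (Om w) y"
    using second v w by simp
  \<comment> \<open>Once both derivatives of \<open>pinv\<close> are substituted, the term with
    \<open>pd P (Om v) y * pd P (Om w) y * pd X pinv x\<close> occurs on both sides and cancels; the
    difference of the two sides is then the curvature.\<close>
  thus ?thesis
    unfolding curvature_def bracket_def y_def[symmetric] pinv_v[OF v] pinv_v[OF w]
    by algebra
qed

text \<open>The identity theorem in the fibre over the times of x, run in a connected set C that
  contains the fibre of U. The hypothesis \<open>ext\<close> continues the first derivatives alone:
  a logarithm need not have a single-valued continuation to C.\<close>

lemma curvature_eq_zero:
  fixes Om :: "'i \<Rightarrow> ('i \<Rightarrow> complex) \<Rightarrow> complex"
  assumes P: "P \<notin> J" and X: "X \<in> J" and K: "K = insert P J"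
    and Om: "\<And>v. v \<in> J \<Longrightarrow> plane_holomorphic K (Om v) U"
    and OmX: "\<And>x. x \<in> U \<Longrightarrow> Om X x = x P"
    and S: "plane_holomorphic K S G" and pinv: "plane_holomorphic K pinv G"
    and pinv_in: "\<And>x. x \<in> G \<Longrightarrow> x(P := pinv x) \<in> U"
    and pinv_inv: "\<And>x. x \<in> G \<Longrightarrow> Z (x(P := pinv x)) = x P"
    and dS: "\<And>v x. v \<in> J \<Longrightarrow> x \<in> G \<Longrightarrow> pd v S x = Om v (x(P := pinv x))"
    and x: "x \<in> U" and v: "v \<in> J" and w: "w \<in> J"
    and G: "x(P := \<zeta>) \<in> G"
    and C: "open C" "connected C" "\<And>s. x(P := s) \<in> U \<Longrightarrow> s \<in> C"
    and ext: "\<And>v u. v \<in> J \<Longrightarrow> u \<in> K \<Longrightarrow>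
      \<exists>R. R holomorphic_on C \<and> (\<forall>s. x(P := s) \<in> U \<longrightarrow> pd u (Om v) (x(P := s)) = R s)"
  shows "curvature P X v w (Om v) (Om w) x = 0"
proof -
  have PX: "P \<noteq> X" "P \<in> K" "X \<in> K" "v \<in> K" "w \<in> K" using P X K v w by auto
  obtain R where R: "\<And>v u. v \<in> J \<Longrightarrow> u \<in> K \<Longrightarrow> R v u holomorphic_on C"
    "\<And>v u s. v \<in> J \<Longrightarrow> u \<in> K \<Longrightarrow> x(P := s) \<in> U \<Longrightarrow> pd u (Om v) (x(P := s)) = R v u s"
    using ext by metis
  \<comment> \<open>The curvature with each derivative replaced by its continuation; it is defined
    and holomorphic on all of C, also where \<open>x(P := s)\<close> leaves U.\<close>
  define Q where "Q = (\<lambda>s. R v w s - R w v s + (R v P s * R w X s - R v X s * R w P s))"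
  have Q: "Q holomorphic_on C"
    unfolding Q_def using R(1) v w PX by (intro holomorphic_intros) auto
  have curv: "curvature P X v w (Om v) (Om w) (x(P := s)) = Q s" if "x(P := s) \<in> U" for s
    unfolding curvature_def bracket_def Q_def using R(2) v w PX that by simp
  define Z0 where "Z0 = {s. x(P := s) \<in> G}"
  define p where "p = (\<lambda>s. pinv (x(P := s)))"
  have "open Z0"
    using plane_open_line[OF plane_holomorphic_imp_plane_open[OF S] G PX(2,3,1)] by (simp add: Z0_def)
  moreover have "p holomorphic_on Z0"
    unfolding p_def Z0_def using plane_holomorphic_line[OF pinv PX(2,3,1)] .
  moreover have "inj_on p Z0"
  proof (rule inj_on_inverseI)
    show "Z (x(P := p s)) = s" if "s \<in> Z0" for s
      using pinv_inv[of "x(P := s)"] that by (simp add: Z0_def p_def)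
  qed
  ultimately have "open (p ` Z0)" by (intro open_mapping_thm3)
  moreover have in_U: "x(P := p s) \<in> U" if "s \<in> Z0" for s
    using pinv_in[of "x(P := s)"] that by (simp add: Z0_def p_def)
  moreover have "Q (p s) = 0" if "s \<in> Z0" for s
  proof -
    have "curvature P X v w (Om v) (Om w) ((x(P := s))(P := pinv (x(P := s)))) = 0"
      by (rule curvature_on_graph[OF P X K Om OmX S pinv pinv_in dS _ v w]) (use that in \<open>auto simp: Z0_def\<close>)
    thus ?thesis using curv[OF in_U[OF that]] by (simp add: p_def)
  qed
  ultimately have "Q (x P) = 0"
    using C G Q x
    by (intro analytic_continuation_open[of "p ` Z0" C Q "\<lambda>_. 0" "x P"]) (auto simp: Z0_def)
  thus ?thesis using curv[of "x P"] x by simp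
qed

subsection \<open>The spectral variable and the times as coordinates\<close>

text \<open>A pair \<open>(p, t)\<close> is encoded as one family of coordinates: \<^term>\<open>None\<close> is the index of \<open>p\<close>,
  \<^term>\<open>Some A\<close> that of \<open>t\<^sub>A\<close>.\<close>

definition lift :: "(complex \<Rightarrow> times \<Rightarrow> complex) \<Rightarrow> ((nat \<times> nat) option \<Rightarrow> complex) \<Rightarrow> complex" where
  "lift F x = F (x None) (x \<circ> Some)"

definition lift_set :: "(complex \<times> times) set \<Rightarrow> ((nat \<times> nat) option \<Rightarrow> complex) set" where
  "lift_set U = {x. (x None, x \<circ> Some) \<in> U}"

definition point :: "complex \<Rightarrow> times \<Rightarrow> (nat \<times> nat) option \<Rightarrow> complex" where
  "point p t = case_option p t"

lemma point_simps [simp]: "point p t None = p" "point p t (Some A) = t A" "point p t \<circ> Some = t"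
  by (auto simp: point_def)

lemma upd_comp_Some [simp]:
  "x(None := s) \<circ> Some = x \<circ> Some" "x(Some A := s) \<circ> Some = (x \<circ> Some)(A := s)"
  by (auto simp: fun_eq_iff)

lemma lift_point [simp]: "lift F (point p t) = F p t"
  by (simp add: lift_def)

lemma point_in_lift_set [simp]: "point p t \<in> lift_set U \<longleftrightarrow> (p, t) \<in> U"
  by (simp add: lift_set_def)

lemma pd_lift:
  "pd None (lift F) x = d_spec F (x None) (x \<circ> Some)"
  "pd (Some A) (lift F) x = d_time A F (x None) (x \<circ> Some)"
  by (simp_all add: lift_def d_spec_def d_time_def pd_def)

lemma bracket_lift:
  "bracket None (Some (1, 1)) (lift F) (lift G) x = poisson F G (x None) (x \<circ> Some)"
  unfolding bracket_def poisson_def pd_lift ..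

lemma lift_lax_op:
  "lift (lax_op Om A F) = lax None (Some (1, 1)) (Some A) (lift (Om A)) (lift F)"
  unfolding fun_eq_iff lax_def bracket_lift pd_lift lift_def[of "lax_op Om A F"] lax_op_def by blast

lemma lift_whitham_curvature:
  "lift (whitham_curvature Om A B)
    = curvature None (Some (1, 1)) (Some A) (Some B) (lift (Om A)) (lift (Om B))"
  unfolding fun_eq_iff curvature_def bracket_lift pd_lift lift_def[of "whitham_curvature Om A B"]
    whitham_curvature_def by blast

text \<open>J collects those of the two directions that are times. The spectral direction needs no
  entry, since p varies in every slice.\<close>

lemma plane_in_slice_ball:
  assumes "v \<noteq> w" "dist y (x v, x w) < r" "J = {A. Some A \<in> {v, w}}"
  shows "(plane v w x y None, plane v w x y \<circ> Some) \<in> slice_ball J (x None) (x \<circ> Some) r"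
proof -
  have "norm (fst y - x v) < r" "norm (snd y - x w) < r"
    using assms(2) dist_fst_le[of y "(x v, x w)"] dist_snd_le[of y "(x v, x w)"]
    by (auto simp: dist_norm)
  moreover from this have "0 < r" using norm_ge_zero[of "fst y - x v"] by linarith
  ultimately show ?thesis
    using assms(1) by (auto simp: slice_ball_def plane_def assms(3))
qed

lemma finite_directions: "finite {A. Some A \<in> {v, w}}"
  using finite_vimageI[of "{v, w}" Some] by (simp add: vimage_def)

lemma plane_open_lift_set:
  assumes "slice_open I U"
  shows "plane_open (insert None (Some ` I)) (lift_set U)"
proof (rule plane_openI)
  fix x v w assume x: "x \<in> lift_set U" and vw: "v \<in> insert None (Some ` I)" "w \<in> insert None (Some ` I)" "v \<noteq> w"
  define J where "J = {A. Some A \<in> {v, w}}"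
  have "finite J" "J \<subseteq> I" using finite_directions vw by (auto simp: J_def)
  then obtain r where r: "r > 0" "slice_ball J (x None) (x \<circ> Some) r \<subseteq> U"
    using assms x unfolding slice_open_def lift_set_def by blast
  have "plane v w x y \<in> lift_set U" if "dist y (x v, x w) < r" for y
    using plane_in_slice_ball[of v w y x r J] vw(3) that r(2) by (auto simp: J_def lift_set_def)
  thus "\<forall>\<^sub>F y in nhds (x v, x w). plane v w x y \<in> lift_set U"
    unfolding eventually_nhds_metric using r(1) by blast
qed

text \<open>A Frechet estimate in p and the times of J restricts to the plane spanned by two of
  these directions. If neither of them is p, the term with c vanishes on the plane.\<close>

lemma plane_holomorphic_lift:
  assumes "slice_holomorphic I F U"
  shows "plane_holomorphic (insert None (Some ` I)) (lift F) (lift_set U)"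
proof (rule plane_holomorphicI)
  show "plane_open (insert None (Some ` I)) (lift_set U)"
    using assms by (intro plane_open_lift_set) (simp add: slice_holomorphic_def)
  fix x v w assume x: "x \<in> lift_set U" and vw: "v \<in> insert None (Some ` I)" "w \<in> insert None (Some ` I)" "v \<noteq> w"
  define J where "J = {A. Some A \<in> {v, w}}"
  have J: "finite J \<and> J \<subseteq> I" using finite_directions vw by (auto simp: J_def)
  have "(x None, x \<circ> Some) \<in> U" using x by (simp add: lift_set_def)
  from bspec[OF conjunct2[OF assms[unfolded slice_holomorphic_def]] this, unfolded prod.case,
      THEN spec, of J, THEN mp, OF J]
  obtain c d where cd: "\<forall>e>0. \<exists>r>0. \<forall>(p', t')\<in>slice_ball J (x None) (x \<circ> Some) r.
           norm (F p' t' - F (x None) (x \<circ> Some) - c * (p' - x None) - (\<Sum>A\<in>J. d A * (t' A - (x \<circ> Some) A)))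
             \<le> e * (norm (p' - x None) + (\<Sum>A\<in>J. norm (t' A - (x \<circ> Some) A)))"
    by (elim exE) (rule that)
  define l where "l = case_option c d"
  have "((\<lambda>y. lift F (plane v w x y)) has_derivative (\<lambda>k. l v * fst k + l w * snd k)) (at (x v, x w))"
    unfolding has_derivative_at_alt
  proof (intro conjI allI impI)
    show "bounded_linear (\<lambda>k. l v * fst k + l w * snd k)"
      by (intro bounded_linear_add bounded_linear_const_mult bounded_linear_fst bounded_linear_snd)
    fix e :: real assume e: "e > 0"
    \<comment> \<open>Half of e, because the norms of the two coordinates are added and each is at
      most the norm of the pair.\<close>
    then obtain r where r: "r > 0" "\<forall>(p', t')\<in>slice_ball J (x None) (x \<circ> Some) r.
           norm (F p' t' - F (x None) (x \<circ> Some) - c * (p' - x None) - (\<Sum>A\<in>J. d A * (t' A - (x \<circ> Some) A)))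
             \<le> e / 2 * (norm (p' - x None) + (\<Sum>A\<in>J. norm (t' A - (x \<circ> Some) A)))"
      using cd[rule_format, of "e / 2"] by auto
    show "\<exists>r>0. \<forall>y. norm (y - (x v, x w)) < r \<longrightarrow>
        norm (lift F (plane v w x y) - lift F (plane v w x (x v, x w))
          - (l v * fst (y - (x v, x w)) + l w * snd (y - (x v, x w)))) \<le> e * norm (y - (x v, x w))"
    proof (intro exI[of _ r] conjI allI impI r(1))
      fix y assume y: "norm (y - (x v, x w)) < r"
      define p' t' where "p' = plane v w x y None" and "t' = plane v w x y \<circ> Some"
      have "(p', t') \<in> slice_ball J (x None) (x \<circ> Some) r"
        using plane_in_slice_ball[of v w y x r J] vw(3) y
        by (simp add: J_def p'_def t'_def dist_norm)
      with r(2) have le: "norm (F p' t' - F (x None) (x \<circ> Some) - c * (p' - x None) - (\<Sum>A\<in>J. d A * (t' A - (x \<circ> Some) A)))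
             \<le> e / 2 * (norm (p' - x None) + (\<Sum>A\<in>J. norm (t' A - (x \<circ> Some) A)))"
        by blast
      have *: "c * (p' - x None) + (\<Sum>A\<in>J. d A * (t' A - (x \<circ> Some) A))
          = l v * (fst y - x v) + l w * (snd y - x w) \<and>
        norm (p' - x None) + (\<Sum>A\<in>J. norm (t' A - (x \<circ> Some) A))
          = norm (fst y - x v) + norm (snd y - x w)"
      proof (cases v; cases w)
        fix A assume "v = None" "w = Some A"
        moreover from this have "J = {A}" by (auto simp: J_def)
        ultimately show ?thesis by (simp add: p'_def t'_def plane_def l_def)
      next
        fix A assume "v = Some A" "w = None"
        moreover from this have "J = {A}" by (auto simp: J_def)
        ultimately show ?thesis by (simp add: p'_def t'_def plane_def l_def)
      next
        fix A B assume "v = Some A" "w = Some B"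
        moreover from this have "J = {A, B}" by (auto simp: J_def)
        ultimately show ?thesis using vw(3) by (simp add: p'_def t'_def plane_def l_def)
      qed (use vw(3) in auto)
      have "norm (lift F (plane v w x y) - lift F (plane v w x (x v, x w))
          - (l v * fst (y - (x v, x w)) + l w * snd (y - (x v, x w))))
        = norm (F p' t' - F (x None) (x \<circ> Some) - (l v * (fst y - x v) + l w * (snd y - x w)))"
        by (simp add: lift_def p'_def t'_def)
      also have "\<dots> \<le> e / 2 * (norm (fst y - x v) + norm (snd y - x w))"
        using le unfolding *[THEN conjunct1, symmetric] *[THEN conjunct2, symmetric]
        by (simp only: diff_diff_eq add.assoc)
      also have "\<dots> \<le> e / 2 * (norm (y - (x v, x w)) + norm (y - (x v, x w)))"
        using e by (intro mult_left_mono add_mono; cases y) (simp_all add: norm_fst_le norm_snd_le)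
      finally show "norm (lift F (plane v w x y) - lift F (plane v w x (x v, x w))
          - (l v * fst (y - (x v, x w)) + l w * snd (y - (x v, x w)))) \<le> e * norm (y - (x v, x w))"
        by simp
    qed
  qed
  thus "\<exists>c d. ((\<lambda>y. lift F (plane v w x y)) has_derivative (\<lambda>k. c * fst k + d * snd k)) (at (x v, x w))"
    by blast
qed

subsection \<open>Laurent coefficients\<close>

text \<open>The common shape of both kinds of expansion in a local parameter w: w = 1/p with c = 1
  at infinity, and w = p - q_i with c = a_(i,-1) at a finite pole.\<close>

definition pole_fls :: "complex \<Rightarrow> (nat \<Rightarrow> complex) \<Rightarrow> complex fls" where
  "pole_fls c b = fls_const c * fls_X_inv + fps_to_fls (Abs_fps b)"

lemma pole_fls_nth: "pole_fls c b $$ k = (if k = -1 then c else if k < 0 then 0 else b (nat k))"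
  by (simp add: pole_fls_def)

lemma fls_subdegree_pole_fls: "c \<noteq> 0 \<Longrightarrow> fls_subdegree (pole_fls c b) = -1"
  by (rule fls_subdegree_eqI) (auto simp: pole_fls_nth)

text \<open>Convergence at a single nonzero w already forces a positive radius of convergence, so
  the formal series represents a holomorphic function near 0.\<close>

lemma has_laurent_expansion_pole_fls:
  assumes "\<forall>\<^sub>F w in at 0. (\<lambda>n. b n * w ^ n) sums (g w - c / w)"
  shows "g has_laurent_expansion pole_fls c b"
proof -
  have "\<forall>\<^sub>F w in at (0 :: complex). w \<noteq> 0" by (simp add: eventually_at_filter)
  with assms have "\<forall>\<^sub>F w in at 0. (\<lambda>n. b n * w ^ n) sums (g w - c / w) \<and> w \<noteq> 0"
    by eventually_elim simp
  then obtain w where w: "(\<lambda>n. b n * w ^ n) sums (g w - c / w)" "w \<noteq> 0"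
    using eventually_happens'[of "at (0 :: complex)"] by auto
  have "ereal (norm w) \<le> fps_conv_radius (Abs_fps b)"
    unfolding fps_conv_radius_def using w(1) by (intro conv_radius_geI) (simp add: sums_iff)
  hence "fps_conv_radius (Abs_fps b) > 0"
    using w(2) by (auto intro: less_le_trans[of _ "ereal (norm w)"])
  hence "eval_fps (Abs_fps b) has_fps_expansion Abs_fps b"
    by (simp add: has_fps_expansion_def)
  hence "(\<lambda>w. c * inverse w + eval_fps (Abs_fps b) w) has_laurent_expansion pole_fls c b"
    unfolding pole_fls_def by (intro laurent_expansion_intros has_laurent_expansion_fps)
  moreover have ev: "\<forall>\<^sub>F w in at 0. c * inverse w + eval_fps (Abs_fps b) w = g w"
    using assms by eventually_elim (auto simp: eval_fps_def sums_iff divide_inverse)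
  ultimately show ?thesis using has_laurent_expansion_cong[OF ev refl] by blast
qed

text \<open>Series bounded below multiply by finite convolutions, so each coefficient of
  \<open>L x ^ n\<close> is a polynomial in finitely many coefficients of
  \<open>L x\<close>.\<close>

lemma plane_holomorphic_fls_power:
  fixes L :: "('i \<Rightarrow> complex) \<Rightarrow> complex fls"
  assumes U: "plane_open K U" and L: "\<And>x. x \<in> U \<Longrightarrow> fls_subdegree (L x) = -1"
    and hol: "\<And>k. plane_holomorphic K (\<lambda>x. L x $$ k) U"
  shows "plane_holomorphic K (\<lambda>x. (L x ^ n) $$ k) U"
proof (induction n arbitrary: k)
  case 0
  show ?case using U by (simp add: plane_holomorphic_const)
next
  case (Suc n)
  \<comment> \<open>The first factor starts at index -1 and the second at index -n; k - i \<ge> -n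
    is the upper limit i \<le> k + n.\<close>
  have "plane_holomorphic K (\<lambda>x. \<Sum>i=-1..k + int n. L x $$ i * (L x ^ n) $$ (k - i)) U"
    by (intro plane_holomorphic_sum plane_holomorphic_mult U hol Suc.IH)
  moreover have "(\<Sum>i=-1..k + int n. L x $$ i * (L x ^ n) $$ (k - i)) = (L x ^ Suc n) $$ k" if "x \<in> U" for x
    using fls_times_nth(2)[of "L x" "L x ^ n" k] L[OF that] by (simp add: fls_subdegree_pow)
  ultimately show ?case by (rule plane_holomorphic_cong)
qed

lemma poly_fls_prpart:
  fixes F :: "complex fls"
  assumes "fls_subdegree F = - int n"
  shows "poly (fls_prpart F) y = (\<Sum>k=1..n. F $$ (- int k) * y ^ k)"
proof -
  have "poly (fls_prpart F) y = (\<Sum>k\<le>n. coeff (fls_prpart F) k * y ^ k)"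
    by (simp add: poly_altdef assms)
  \<comment> \<open>\<open>fls_prpart\<close> collects negative powers only, so its coefficient at 0
    vanishes and the sum starts at 1.\<close>
  also have "\<dots> = (\<Sum>k=1..n. F $$ (- int k) * y ^ k)"
    by (rule sum.mono_neutral_cong_right) auto
  finally show ?thesis .
qed

text \<open>The hypothesis concerns large p, but the formula holds for every p: the polynomial part
  is determined by the Laurent coefficients alone.\<close>

lemma whitham_Omega_infinity:
  assumes "\<forall>\<^sub>F p in at_infinity. (\<lambda>n. b (Suc n) / p ^ Suc n) sums (z 1 p t - p)" and "n \<ge> 1"
  defines "L \<equiv> pole_fls 1 (\<lambda>n. if n = 0 then 0 else b n)"
  shows "whitham_Omega z q lg (1, n) p t = (L ^ n) $$ 0 + (\<Sum>k=1..n. (L ^ n) $$ (- int k) * p ^ k)"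
proof -
  have "\<forall>\<^sub>F w in at 0. (\<lambda>n. b (Suc n) / inverse w ^ Suc n) sums (z 1 (inverse w) t - inverse w)"
    using eventually_compose_filterlim[OF assms(1) filterlim_inverse_at_infinity] .
  hence "\<forall>\<^sub>F w in at 0. (\<lambda>n. (if n = 0 then 0 else b n) * w ^ n) sums (z 1 (inverse w) t - 1 / w)"
  proof eventually_elim
    case (elim w)
    \<comment> \<open>The expansion of z_1 - p starts with 1/p; supplying the constant term 0 turns
      the shifted sum into a power series in w = 1/p.\<close>
    have "(\<lambda>n. b (Suc n) / inverse w ^ Suc n) = (\<lambda>n. (if Suc n = 0 then 0 else b (Suc n)) * w ^ Suc n)"
      by (auto simp: fun_eq_iff field_simps)
    with elim show ?case
      using sums_Suc_iff[of "\<lambda>n. (if n = 0 then 0 else b n) * w ^ n" "z 1 (inverse w) t - 1 / w"]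
      by (simp add: inverse_eq_divide)
  qed
  hence "(\<lambda>w. z 1 (inverse w) t) has_laurent_expansion L"
    unfolding L_def by (rule has_laurent_expansion_pole_fls)
  hence "laurent_expansion (\<lambda>w. z 1 (inverse w) t ^ n) 0 = L ^ n"
    by (intro laurent_expansion_0_eqI has_laurent_expansion_power)
  moreover have "fls_subdegree (L ^ n) = - int n"
    by (simp add: L_def fls_subdegree_pow fls_subdegree_pole_fls)
  ultimately show ?thesis
    using assms(2) by (simp add: whitham_Omega_def poly_part_at_infinity_def Let_def poly_fls_prpart)
qed

lemma whitham_Omega_pole:
  assumes "\<forall>\<^sub>F p in at (q \<alpha> t). (\<lambda>n. b n * (p - q \<alpha> t) ^ n) sums (z \<alpha> p t - c / (p - q \<alpha> t))"
    and "c \<noteq> 0" "\<alpha> \<noteq> 1" "n \<ge> 1"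
  shows "whitham_Omega z q lg (\<alpha>, n) p t
    = (\<Sum>k=1..n. (pole_fls c b ^ n) $$ (- int k) * inverse (p - q \<alpha> t) ^ k)"
proof -
  have "\<forall>\<^sub>F w in at 0. (\<lambda>n. b n * w ^ n) sums (z \<alpha> (q \<alpha> t + w) t - c / w)"
    using assms(1) unfolding at_to_0[of "q \<alpha> t"] by (simp add: eventually_filtermap add.commute)
  hence "(\<lambda>w. z \<alpha> (q \<alpha> t + w) t) has_laurent_expansion pole_fls c b"
    by (rule has_laurent_expansion_pole_fls)
  hence "laurent_expansion (\<lambda>w. z \<alpha> w t ^ n) (q \<alpha> t) = pole_fls c b ^ n"
    by (intro laurent_expansion_eqI has_laurent_expansion_power)
  moreover have "fls_subdegree (pole_fls c b ^ n) = - int n"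
    using assms(2) by (simp add: fls_subdegree_pow fls_subdegree_pole_fls)
  ultimately show ?thesis
    using assms(3,4) by (simp add: whitham_Omega_def singular_part_at_def poly_fls_prpart)
qed

section \<open>The functions Omega_A on the punctured planes, the hierarchy and its
  compatibility\<close>

theorem proposition1:
  fixes M :: nat
    and I :: "(nat \<times> nat) set"                      (* the index set of the times *)
    and T :: "times set"
    and D :: "complex set"                           (* finite part of the neighbourhood of infinity *)
    and z :: "nat \<Rightarrow> complex \<Rightarrow> times \<Rightarrow> complex"
    and q :: "nat \<Rightarrow> times \<Rightarrow> complex"
    and a :: "nat \<Rightarrow> int \<Rightarrow> times \<Rightarrow> complex"
    and f :: "nat \<Rightarrow> complex \<Rightarrow> complex"
    and lg :: "nat \<Rightarrow> complex \<Rightarrow> times \<Rightarrow> complex"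
    and U :: "(complex \<times> times) set"                (* domain of the branches lg, in (p, t) *)
    and pinv S :: "complex \<Rightarrow> times \<Rightarrow> complex"
    and G :: "(complex \<times> times) set"                (* domain of S, in (z, t) *)
  defines "I \<equiv> whitham_index M"
  assumes M: "1 \<le> M"
    and T: "T \<subseteq> extensional I" "slice_open I (UNIV \<times> T)"
    and D: "open D" "\<forall>\<^sub>F p in at_infinity. p \<in> D"
    and q: "\<And>i. i \<in> {2..M} \<Longrightarrow> slice_holomorphic I (\<lambda>_. q i) (UNIV \<times> T)"
    and q_in: "\<And>i t. i \<in> {2..M} \<Longrightarrow> t \<in> T \<Longrightarrow> q i t \<in> D"
    and a1_holo: "\<And>n. 1 \<le> n \<Longrightarrow> slice_holomorphic I (\<lambda>_. a 1 n) (UNIV \<times> T)"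
    and ai_holo: "\<And>i n. i \<in> {2..M} \<Longrightarrow> -1 \<le> n \<Longrightarrow> slice_holomorphic I (\<lambda>_. a i n) (UNIV \<times> T)"
    and z1_holo: "slice_holomorphic I (z 1) (D \<times> T)"
    and zi_holo: "\<And>i. i \<in> {2..M} \<Longrightarrow>
           slice_holomorphic I (z i) {(p, t). p \<in> D \<and> t \<in> T \<and> p \<noteq> q i t}"
    and zi_infinity: "\<And>i t. i \<in> {2..M} \<Longrightarrow> t \<in> T \<Longrightarrow> \<exists>l. ((\<lambda>p. z i p t) \<longlongrightarrow> l) at_infinity"
    and z1_laurent: "\<And>t. t \<in> T \<Longrightarrow>
           \<forall>\<^sub>F p in at_infinity. (\<lambda>n. a 1 (int (Suc n)) t / p ^ Suc n) sums (z 1 p t - p)"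
    and zi_laurent: "\<And>i t. i \<in> {2..M} \<Longrightarrow> t \<in> T \<Longrightarrow>
           \<forall>\<^sub>F p in at (q i t).
             (\<lambda>n. a i (int n) t * (p - q i t) ^ n) sums (z i p t - a i (-1) t / (p - q i t))"
    and zi_pole: "\<And>i t. i \<in> {2..M} \<Longrightarrow> t \<in> T \<Longrightarrow> a i (-1) t \<noteq> 0"
    and relation: "\<And>i p t. i \<in> {2..M} \<Longrightarrow> t \<in> T \<Longrightarrow> p \<in> D \<Longrightarrow> p \<noteq> q i t \<Longrightarrow>
           z i p t = f i (z 1 p t)"
    and U: "slice_open I U" "U \<subseteq> D \<times> T"
    and lg_holo: "\<And>i. i \<in> {2..M} \<Longrightarrow> slice_holomorphic I (lg i) U"
    and lg: "\<And>i p t. i \<in> {2..M} \<Longrightarrow> (p, t) \<in> U \<Longrightarrow> exp (lg i p t) = p - q i t"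
    and G: "G \<subseteq> UNIV \<times> T" "\<And>t. t \<in> T \<Longrightarrow> \<exists>\<zeta>. (\<zeta>, t) \<in> G"
    and pinv_holo: "slice_holomorphic I pinv G"
    and pinv_infinity: "\<And>t. t \<in> T \<Longrightarrow> \<forall>\<^sub>F p in at_infinity. pinv (z 1 p t) t = p"
    and pinv_in: "\<And>\<zeta> t. (\<zeta>, t) \<in> G \<Longrightarrow> (pinv \<zeta> t, t) \<in> U"
    and pinv: "\<And>\<zeta> t. (\<zeta>, t) \<in> G \<Longrightarrow> z 1 (pinv \<zeta> t) t = \<zeta>"
    and S_holo: "slice_holomorphic I S G"
    and S: "\<And>A \<zeta> t. A \<in> I \<Longrightarrow> (\<zeta>, t) \<in> G \<Longrightarrow>
           d_time A S \<zeta> t = whitham_Omega z q lg A (pinv \<zeta> t) t"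
  shows "whitham_hierarchy_on I (whitham_Omega z q lg) U \<and>
         lax_compatibility_on I (whitham_Omega z q lg) U"
proof -
  define K where "K = insert None (Some ` I)"
  \<comment> \<open>The family is evaluated only at indices \<open>Some A\<close>, so the
    unspecified value of \<open>the None\<close> never enters.\<close>
  define Om where "Om = (\<lambda>v. lift (whitham_Omega z q lg (the v)))"
  define TT where "TT = lift_set (UNIV \<times> T)"
  define UU where "UU = lift_set U"
  define g where "g = (\<lambda>i x. x None - q i (x \<circ> Some))"
  \<comment> \<open>The condition on p does not mention D: the Omega_A with n \<ge> 1 are rational
    in p with poles only at the q_i, so they live on W. One product over all i lets a single
    non-vanishing condition give openness.\<close>
  define W where "W = {x \<in> TT. (\<Prod>i\<in>{2..M}. g i x) \<noteq> 0}"
  have W_iff: "x \<in> W \<longleftrightarrow> x \<in> TT \<and> (\<forall>i\<in>{2..M}. g i x \<noteq> 0)" for x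
    by (auto simp: W_def)
  have idx: "(1, 1) \<in> I" using M by (auto simp: I_def whitham_index_def)
  have K: "None \<in> K" "Some (1, 1) \<in> K" using idx by (auto simp: K_def)
  have K2: "\<exists>w\<in>K. w \<noteq> u" for u using K by (metis option.distinct(1))
  have TT_open: "plane_open K TT"
    unfolding K_def TT_def by (rule plane_open_lift_set[OF T(2)])
  have coeff: "plane_holomorphic K (\<lambda>x. b (x \<circ> Some)) TT"
    if "slice_holomorphic I (\<lambda>_. b) (UNIV \<times> T)" for b
    using plane_holomorphic_lift[OF that] by (simp add: K_def TT_def lift_def[abs_def])
  have g_hol: "plane_holomorphic K (g i) TT" if "i \<in> {2..M}" for i
    unfolding g_def
    by (intro plane_holomorphic_diff plane_holomorphic_coordinate coeff q that TT_open)
  have W_open: "plane_open K W"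
    unfolding W_def by (intro plane_open_nonzero plane_holomorphic_prod TT_open g_hol)
  have UU_open: "plane_open K UU"
    unfolding K_def UU_def by (rule plane_open_lift_set[OF U(1)])
  have log_g: "exp (lift (lg i) x) = g i x" if "i \<in> {2..M}" "x \<in> UU" for i x
    using lg[OF that(1), of "x None" "x \<circ> Some"] that(2) by (simp add: lift_def g_def UU_def lift_set_def)
  \<comment> \<open>Since exp has no zeros, a branch of ln(p - q_i) can exist only where p differs
    from q_i.\<close>
  have UU_W: "UU \<subseteq> W"
  proof
    fix x assume x: "x \<in> UU"
    hence "x \<in> TT" using U(2) by (auto simp: UU_def TT_def lift_set_def)
    moreover have "g i x \<noteq> 0" if "i \<in> {2..M}" for i
      using log_g[OF that x] exp_not_eq_zero by metis
    ultimately show "x \<in> W" by (simp add: W_iff)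
  qed
  have WT: "x \<circ> Some \<in> T" if "x \<in> W" for x
    using that by (simp add: W_iff TT_def lift_set_def)

  define b where "b = (\<lambda>t n. if n = 0 then 0 else a 1 (int n) t)"
  have infinity: "whitham_Omega z q lg (1, n) p t
      = (pole_fls 1 (b t) ^ n) $$ 0 + (\<Sum>k=1..n. (pole_fls 1 (b t) ^ n) $$ (- int k) * p ^ k)"
    if "t \<in> T" "n \<ge> 1" for n p t
    using whitham_Omega_infinity[of "\<lambda>n. a 1 (int n) t" z t n q lg p, OF z1_laurent[OF that(1)] that(2)]
    by (simp add: b_def)
  have pole: "whitham_Omega z q lg (i, n) p t
      = (\<Sum>k=1..n. (pole_fls (a i (-1) t) (\<lambda>n. a i (int n) t) ^ n) $$ (- int k) * inverse (p - q i t) ^ k)"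
    if "t \<in> T" "n \<ge> 1" "i \<in> {2..M}" for i n p t
    using zi_laurent[OF that(3,1)] zi_pole[OF that(3,1)] that
    by (intro whitham_Omega_pole) auto
  have hol1: "plane_holomorphic K (lift (whitham_Omega z q lg (1, n))) W" if n: "n \<ge> 1" for n
  proof -
    have "plane_holomorphic K (\<lambda>x. pole_fls 1 (b (x \<circ> Some)) $$ k) TT" for k
    proof (cases "1 \<le> k")
      case True
      thus ?thesis using coeff[OF a1_holo[OF True]] by (simp add: pole_fls_nth b_def)
    next
      case False
      hence "pole_fls 1 (b t) $$ k = (if k = -1 then 1 else 0)" for t
        by (auto simp: pole_fls_nth b_def)
      thus ?thesis
        using plane_holomorphic_const[OF TT_open, of "if k = -1 then 1 else 0"] by simp
    qed
    hence "plane_holomorphic K (\<lambda>x. (pole_fls 1 (b (x \<circ> Some)) ^ n) $$ k) TT" for k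
      by (intro plane_holomorphic_fls_power TT_open) (auto simp: fls_subdegree_pole_fls)
    hence "plane_holomorphic K (\<lambda>x. (pole_fls 1 (b (x \<circ> Some)) ^ n) $$ 0
        + (\<Sum>k=1..n. (pole_fls 1 (b (x \<circ> Some)) ^ n) $$ (- int k) * x None ^ k)) TT"
      by (intro plane_holomorphic_add plane_holomorphic_sum plane_holomorphic_mult
          plane_holomorphic_power plane_holomorphic_coordinate TT_open)
    hence "plane_holomorphic K (\<lambda>x. (pole_fls 1 (b (x \<circ> Some)) ^ n) $$ 0
        + (\<Sum>k=1..n. (pole_fls 1 (b (x \<circ> Some)) ^ n) $$ (- int k) * x None ^ k)) W"
      by (rule plane_holomorphic_mono) (auto simp: W_open W_iff)
    thus ?thesis
      by (rule plane_holomorphic_cong) (simp only: lift_def infinity[OF WT n])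
  qed
  have holi: "plane_holomorphic K (lift (whitham_Omega z q lg (i, n))) W"
    if n: "n \<ge> 1" and i: "i \<in> {2..M}" for i n
  proof -
    define L where "L = (\<lambda>x. pole_fls (a i (-1) (x \<circ> Some)) (\<lambda>n. a i (int n) (x \<circ> Some)))"
    have "plane_holomorphic K (\<lambda>x. L x $$ k) TT" for k
    proof (cases "k < -1")
      case True
      thus ?thesis using plane_holomorphic_const[OF TT_open] by (simp add: L_def pole_fls_nth)
    next
      case False
      hence "L x $$ k = a i k (x \<circ> Some)" for x by (auto simp: L_def pole_fls_nth)
      thus ?thesis using coeff[OF ai_holo[OF i, of k]] False by simp
    qed
    hence "plane_holomorphic K (\<lambda>x. L x $$ k) W" for k
      by (rule plane_holomorphic_mono) (auto simp: W_open W_iff)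
    \<comment> \<open>By \<open>zi_pole\<close> the pole has order exactly one, so the series starts
      at index -1 for every t, as the convolution requires.\<close>
    hence "plane_holomorphic K (\<lambda>x. (L x ^ n) $$ k) W" for k
      using zi_pole[OF i WT]
      by (intro plane_holomorphic_fls_power W_open) (auto simp: L_def fls_subdegree_pole_fls)
    moreover have "plane_holomorphic K (\<lambda>x. inverse (g i x)) W"
      by (intro plane_holomorphic_inverse plane_holomorphic_mono[OF g_hol[OF i]] W_open)
        (use i in \<open>auto simp: W_iff\<close>)
    ultimately have "plane_holomorphic K (\<lambda>x. \<Sum>k=1..n. (L x ^ n) $$ (- int k) * inverse (g i x) ^ k) W"
      by (intro plane_holomorphic_sum plane_holomorphic_mult plane_holomorphic_power W_open)
    thus ?thesis
      by (rule plane_holomorphic_cong) (simp only: lift_def pole[OF WT n i] L_def g_def)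
  qed
  have cases_I: "(\<exists>i\<in>{2..M}. A = (i, 0)) \<or> (\<exists>n\<ge>1. A = (1, n)) \<or> (\<exists>i\<in>{2..M}. \<exists>n\<ge>1. A = (i, n))"
    if "A \<in> I" for A
    using that unfolding I_def whitham_index_def by force
  have holW: "plane_holomorphic K (lift (whitham_Omega z q lg A)) W" if "A \<in> I" "snd A \<noteq> 0" for A
    using cases_I[OF that(1)] that(2) hol1 holi by auto
  have log: "lift (whitham_Omega z q lg (i, 0)) = (\<lambda>x. - lift (lg i) x)" for i
    by (simp add: lift_def whitham_Omega_def fun_eq_iff)
  have lg_hol: "plane_holomorphic K (lift (lg i)) UU" if "i \<in> {2..M}" for i
    unfolding K_def UU_def by (rule plane_holomorphic_lift[OF lg_holo[OF that]])
  have holU: "plane_holomorphic K (lift (whitham_Omega z q lg A)) UU" if A: "A \<in> I" for A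
  proof (cases "snd A = 0")
    case True
    then obtain i where "i \<in> {2..M}" "A = (i, 0)" using cases_I[OF A] by auto
    thus ?thesis using plane_holomorphic_uminus[OF lg_hol] by (simp add: log)
  next
    case False
    show ?thesis by (rule plane_holomorphic_mono[OF holW[OF A False] UU_W UU_open])
  qed

  have zero: "curvature None (Some (1, 1)) (Some A) (Some B)
      (lift (whitham_Omega z q lg A)) (lift (whitham_Omega z q lg B)) x = 0"
    if A: "A \<in> I" and B: "B \<in> I" and x: "x \<in> UU" for A B x
  proof -
    have tT: "x \<circ> Some \<in> T" using x UU_W WT by blast
    obtain \<zeta> where \<zeta>: "(\<zeta>, x \<circ> Some) \<in> G" using G(2)[OF tT] by blast
    define C where "C = {s. x(None := s) \<in> W}"
    \<comment> \<open>The times are fixed along the fibre, hence so are the q_i: only finitely many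
      points are removed and the complement stays connected.\<close>
    have C_eq: "C = UNIV - (\<lambda>i. q i (x \<circ> Some)) ` {2..M}"
      using tT by (auto simp: C_def W_iff TT_def lift_set_def g_def)
    have "curvature None (Some (1, 1)) (Some A) (Some B) (Om (Some A)) (Om (Some B)) x = 0"
    proof (rule curvature_eq_zero[where J = "Some ` I" and U = UU and G = "lift_set G" and C = C
          and S = "lift S" and pinv = "lift pinv" and Z = "lift (z 1)" and Om = Om, OF _ _ K_def])
      show "plane_holomorphic K (Om v) UU" if "v \<in> Some ` I" for v
        using that holU by (auto simp: Om_def)
      \<comment> \<open>Here the normalisation of z_1 enters: leading coefficient 1 and no constant
        term make Omega_(1,1) exactly p.\<close>
      show "Om (Some (1, 1)) x = x None" if "x \<in> UU" for x
        using infinity[of "x \<circ> Some" 1 "x None"] WT UU_W that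
        by (auto simp: Om_def lift_def pole_fls_nth b_def)
      show "plane_holomorphic K (lift S) (lift_set G)"
        unfolding K_def by (rule plane_holomorphic_lift[OF S_holo])
      show "plane_holomorphic K (lift pinv) (lift_set G)"
        unfolding K_def by (rule plane_holomorphic_lift[OF pinv_holo])
      show "x(None := lift pinv x) \<in> UU" if "x \<in> lift_set G" for x
        using pinv_in that by (simp add: UU_def lift_set_def lift_def)
      show "lift (z 1) (x(None := lift pinv x)) = x None" if "x \<in> lift_set G" for x
        using pinv that by (simp add: lift_set_def lift_def)
      show "pd v (lift S) x = Om v (x(None := lift pinv x))" if v: "v \<in> Some ` I" and "x \<in> lift_set G" for v x
      proof -
        obtain A where A: "A \<in> I" "v = Some A" using v by blast
        have "(x None, x \<circ> Some) \<in> G" using that(2) by (simp add: lift_set_def)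
        from S[OF A(1) this] show ?thesis
          unfolding A(2) pd_lift Om_def by (simp add: lift_def)
      qed
      show "x(None := \<zeta>) \<in> lift_set G" using \<zeta> by (simp add: lift_set_def)
      have "finite ((\<lambda>i. q i (x \<circ> Some)) ` {2..M})" by simp
      thus "open C" "connected C"
        unfolding C_eq
        by (auto intro!: connected_open_diff_countable open_Diff finite_imp_closed countable_finite)
      show "s \<in> C" if "x(None := s) \<in> UU" for s
        using that UU_W by (auto simp: C_def)
      show "\<exists>R. R holomorphic_on C \<and> (\<forall>s. x(None := s) \<in> UU \<longrightarrow> pd u (Om v) (x(None := s)) = R s)"
        if v: "v \<in> Some ` I" and u: "u \<in> K" for v u
      proof -
        obtain A where A: "A \<in> I" "v = Some A" using v by blast
        show ?thesis
        proof (cases "snd A = 0")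
          case True
          then obtain i where i: "i \<in> {2..M}" "A = (i, 0)" using cases_I[OF A(1)] by auto
          obtain w where w: "w \<in> K" "u \<noteq> w" using K2 by metis
          have gW: "plane_holomorphic K (g i) W"
            by (rule plane_holomorphic_mono[OF g_hol[OF i(1)] _ W_open]) (auto simp: W_iff)
          \<comment> \<open>The derivative of -ln(p - q_i) in direction u, continued from the fibre
            of U to all of C; its denominator vanishes only at q_i, which C omits.\<close>
          have "(\<lambda>s. - (pd u (g i) (x(None := s)) / g i (x(None := s)))) holomorphic_on C"
            unfolding C_def
            using plane_holomorphic_line[OF gW K(1,2)] pd_line_holomorphic[OF gW u K(1) K2] i(1)
            by (intro holomorphic_intros) (auto simp: W_iff)
          moreover have "pd u (Om v) y = - (pd u (g i) y / g i y)" if y: "y \<in> UU" for y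
          proof -
            have "pd u (Om v) y = - pd u (lift (lg i)) y"
              using plane_holomorphic_DERIV[OF lg_hol[OF i(1)] y u w, THEN DERIV_minus]
              by (simp add: Om_def A i log pd_def[of u "\<lambda>x. - lift (lg i) x"] DERIV_imp_deriv)
            also have "pd u (lift (lg i)) y = pd u (g i) y / g i y"
              by (rule pd_branch_of_log[OF lg_hol[OF i(1)] y u w log_g[OF i(1)]])
            finally show ?thesis .
          qed
          ultimately show ?thesis by blast
        next
          case False
          \<comment> \<open>For n \<ge> 1 the function Omega_A is itself holomorphic on W, whose
            fibre is C, so its derivative is its own continuation.\<close>
          have "(\<lambda>s. pd u (Om v) (x(None := s))) holomorphic_on C"
            using pd_line_holomorphic[OF holW[OF A(1) False] u K(1) K2]
            by (simp add: C_def Om_def A)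
          thus ?thesis by blast
        qed
      qed
    qed (use idx x A B in auto)
    thus ?thesis by (simp add: Om_def)
  qed

  have "whitham_hierarchy_on I (whitham_Omega z q lg) U"
    unfolding whitham_hierarchy_on_def
  proof (intro ballI, safe)
    fix A B p t assume "A \<in> I" "B \<in> I" "(p, t) \<in> U"
    hence "lift (whitham_curvature (whitham_Omega z q lg) A B) (point p t) = 0"
      unfolding lift_whitham_curvature by (intro zero) (auto simp: UU_def)
    thus "whitham_curvature (whitham_Omega z q lg) A B p t = 0" by simp
  qed
  moreover have "lax_compatibility_on I (whitham_Omega z q lg) U"
    unfolding lax_compatibility_on_def
  proof (intro ballI allI impI, safe)
    fix A B V F p t
    assume A: "A \<in> I" and B: "B \<in> I" and V: "V \<subseteq> U" "slice_holomorphic I F V" and pt: "(p, t) \<in> V"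
    let ?Om = "whitham_Omega z q lg"
    have F: "plane_holomorphic K (lift F) (lift_set V)"
      unfolding K_def by (rule plane_holomorphic_lift[OF V(2)])
    \<comment> \<open>V is the common domain of F and the Omega_A; its openness is part of the
      holomorphy of F.\<close>
    have Om_V: "plane_holomorphic K (lift (?Om A)) (lift_set V)" if "A \<in> I" for A
      using V(1) by (intro plane_holomorphic_mono[OF holU[OF that]] plane_holomorphic_imp_plane_open[OF F])
        (auto simp: UU_def lift_set_def)
    have "lift (lax_op ?Om A (lax_op ?Om B F)) (point p t) - lift (lax_op ?Om B (lax_op ?Om A F)) (point p t)
        = bracket None (Some (1, 1)) (lift (whitham_curvature ?Om A B)) (lift F) (point p t)"
      unfolding lift_lax_op lift_whitham_curvature
      by (rule lax_commutator[OF Om_V[OF A] Om_V[OF B] F]) (use A B pt K in \<open>auto simp: K_def\<close>)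
    thus "lax_op ?Om A (lax_op ?Om B F) p t - lax_op ?Om B (lax_op ?Om A F) p t
        = poisson (whitham_curvature ?Om A B) F p t"
      unfolding bracket_lift lift_point by simp
  qed
  ultimately show ?thesis ..
qed

end
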